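(* Let $\bm{\mu}=(\mu_1,\dots,\mu_r)$ be probability measures on $\partial\mathbb{D}$ and let $\bm{n}\in\mathbb{N}^r$. Assume that either (A) $\bm{\mu}$ is an Angelesco system on the unit circle, ordered with respect to $t_0\in\mathbb{R}$ as described in the context and with $\mu_r(\{e^{it_0}\})=0$, and the branch of the square root is the one given by this $t_0$; or (B) $\bm{\mu}$ is an AT system for the multi-index $\bm{n}$ on an arc $\Gamma=\{e^{i\theta}:\alpha\le\theta\le\beta\}$, and the branch of the square root is the one given by $t_0=\alpha$. Put $\ell_j=n_j/2$, $|\bm{\ell}|=|\bm{n}|/2$, and consider the problem of finding $\varphi_{\bm{n}}\in\operatorname{span}\{z^k\}_{k=-|\bm{\ell}|}^{|\bm{\ell}|}$ and functions $\psi_{\bm{n},1},\dots,\psi_{\bm{n},r}$ such that: for every $j$ with $|\bm{n}|-n_j$ even, $\psi_{\bm{n},j}\in\operatorname{span}\{z^k\}_{k=-|\bm{\ell}|}^{|\bm{\ell}|}$ and $$\varphi_{\bm{n}}(z)F_j(z)+\psi_{\bm{n},j}(z)=\mathcal{O}(z^{\ell_j}),\ z\to0,\qquad \varphi_{\bm{n}}(z)F_j(z)+\psi_{\bm{n},j}(z)=\mathcal{O}(z^{-\ell_j-1}),\ z\to\infty;$$ for every $j$ with $|\bm{n}|-n_j$ odd, $\psi_{\bm{n},j}\in\operatorname{span}\{z^k\}_{k=-|\bm{\ell}|+1/2}^{|\bm{\ell}|-1/2}$ and $$\varphi_{\bm{n}}(z)G_j(z)+\psi_{\bm{n},j}(z)=\mathcal{O}(z^{\ell_j}),\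 z\to0,\qquad \varphi_{\bm{n}}(z)G_j(z)+\psi_{\bm{n},j}(z)=\mathcal{O}(z^{-\ell_j-1}),\ z\to\infty.$$ Then this approximation problem has a nonzero solution $\varphi_{\bm{n}}$ that is unique up to a multiplicative normalization.
   Context: $\mathbb{N}=\{0,1,2,\dots\}$; $\partial\mathbb{D}=\{z\in\mathbb{C}:|z|=1\}$; $|\bm{n}|=n_1+\dots+n_r$. Branch given by $t_0\in\mathbb{R}$: $z^{1/2}=|z|^{1/2}\exp(\tfrac{i}{2}\arg z)$ with $\arg z\in[t_0,t_0+2\pi)$; for $m\in\mathbb{Z}$, $z^{m/2}:=(z^{1/2})^m$. For $a,b\in\frac12\mathbb{Z}$ with $b-a\in\mathbb{N}$, $\operatorname{span}\{z^k\}_{k=a}^{b}$ denotes the complex span of $z^a,z^{a+1},\dots,z^b$. For $z\in\mathbb{C}\setminus\partial\mathbb{D}$, $$F_j(z)=\int_{\partial\mathbb{D}}\frac{w+z}{w-z}\,d\mu_j(w),\qquad G_j(z)=\int_{\partial\mathbb{D}}\frac{w^{1/2}z^{1/2}}{w-z}\,d\mu_j(w).$$ Angelesco system: each $\mu_j$ is a probability measure on $\partial\mathbb{D}$ with infinite support, and there exist closed arcs $\Gamma_j\subset\partial\mathbb{D}$ with $\operatorname{supp}\mu_j\subseteq\Gamma_j$ and such that $\Gamma_j\cap\Gamma_k$ has $0$, $1$ or $2$ points whenever $j\ne k$. Ordering: $\Gamma_j=\{e^{i\theta}:\alpha_j\le\theta\le\beta_j\}$ with $t_0\le\alpha_1\le\beta_1\le\alpha_2\le\beta_2\le\dots\le\alpha_r\le\beta_r\le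 t_0+2\pi$. Chebyshev system: continuous real-valued functions $u_1,\dots,u_n$ on $[a,b]$ with $\det(u_j(x_k))_{1\le j,k\le n}\ne0$ for all distinct $x_1,\dots,x_n\in[a,b]$. For a function $f(\theta)$ and $m\in\mathbb{N}$: if $m$ is even, $\operatorname{Trig}_m(f)=\{f(\theta)\cos\frac{2k-1}{2}\theta,\ f(\theta)\sin\frac{2k-1}{2}\theta\}_{k=1}^{m/2}$; if $m$ is odd, $\operatorname{Trig}_m(f)=\{f(\theta)\}\cup\{f(\theta)\cos k\theta,\ f(\theta)\sin k\theta\}_{k=1}^{(m-1)/2}$. AT system for $\bm{n}$ on $\Gamma=\{e^{i\theta}:\alpha\le\theta\le\beta\}$, $0<\beta-\alpha\le2\pi$: there is a probability measure $\mu$ with infinite support on $\Gamma$ such that $d\mu_j(e^{i\theta})=w_j(\theta)\,d\mu(e^{i\theta})$ for $j=1,\dots,r$ (if $\beta-\alpha=2\pi$, points of $\Gamma$ are parametrized by $\theta\in[\alpha,\alpha+2\pi)$), and the collection of $|\bm{n}|$ functions $\bigcup_{j=1}^r\operatorname{Trig}_{n_j}(w_j)$ (listed with repetition) is Chebyshev on $[\alpha,\beta]$. *)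

theory Defs
  imports "HOL-Probability.Probability" "HOL-Library.Landau_Symbols"
    "Jordan_Normal_Form.Determinant"
begin

section \<open>The branch of the square root\<close>

text \<open>The value of the argument in \<open>[t0, t0 + 2\<pi>)\<close>; at \<open>0\<close>, where it plays no role, it is \<open>t0\<close>.\<close>

definition arg_from :: "real \<Rightarrow> complex \<Rightarrow> real" where
  "arg_from t0 z = t0 + Arg2pi (z * cis (- t0))"

lemma arg_from_range: "t0 \<le> arg_from t0 z" "arg_from t0 z < t0 + 2 * pi"
  using Arg2pi_ge_0[of "z * cis (- t0)"] Arg2pi_lt_2pi[of "z * cis (- t0)"]
  by (simp_all add: arg_from_def)

lemma arg_from_eq: "z = of_real (cmod z) * cis (arg_from t0 z)"
proof -
  have "z * cis (- t0) = of_real (cmod z) * cis (Arg2pi (z * cis (- t0)))"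
    using Arg2pi_eq[of "z * cis (- t0)"] by (simp add: norm_mult cis_conv_exp)
  then have "z * cis (- t0) * cis t0 = of_real (cmod z) * cis (Arg2pi (z * cis (- t0))) * cis t0"
    by simp
  then show ?thesis
    by (simp add: arg_from_def mult.assoc cis_mult add.commute)
qed

definition sqrt_from :: "real \<Rightarrow> complex \<Rightarrow> complex" where
  "sqrt_from t0 z = of_real (sqrt (cmod z)) * exp (\<i> / 2 * of_real (arg_from t0 z))"

text \<open>Half-integer powers and spans of them are indexed by twice the exponent:
  \<open>half_pow t0 m z\<close> is \<open>z\<^bsup>m/2\<^esup>\<close>, and \<open>half_span t0 a b\<close> is the complex span of
  \<open>z\<^bsup>a/2\<^esup>, z\<^bsup>a/2+1\<^esup>, \<dots>, z\<^bsup>b/2\<^esup>\<close> as functions on the punctured plane. Values at \<open>0\<close>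
  are left unconstrained.\<close>

definition half_pow :: "real \<Rightarrow> int \<Rightarrow> complex \<Rightarrow> complex" where
  "half_pow t0 m z = sqrt_from t0 z powi m"

definition half_span :: "real \<Rightarrow> int \<Rightarrow> int \<Rightarrow> (complex \<Rightarrow> complex) set" where
  "half_span t0 a b = {f. \<exists>c :: int \<Rightarrow> complex. \<forall>z. z \<noteq> 0 \<longrightarrow>
     f z = (\<Sum>m | a \<le> m \<and> m \<le> b \<and> even (m - a). c m * half_pow t0 m z)}"

section \<open>Measures on the unit circle\<close>

definition circle_prob :: "complex measure \<Rightarrow> bool" where
  "circle_prob M \<longleftrightarrow> prob_space M \<and> sets M = sets (restrict_space borel (sphere 0 1))"

definition circle_support :: "complex measure \<Rightarrow> complex set" where
  "circle_support M = {x \<in> sphere 0 1.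
     \<forall>U. open U \<longrightarrow> x \<in> U \<longrightarrow> emeasure M (U \<inter> sphere 0 1) > 0}"

definition F_transform :: "complex measure \<Rightarrow> complex \<Rightarrow> complex" where
  "F_transform M z = (LINT w|M. (w + z) / (w - z))"

definition G_transform :: "real \<Rightarrow> complex measure \<Rightarrow> complex \<Rightarrow> complex" where
  "G_transform t0 M z = (LINT w|M. sqrt_from t0 w * sqrt_from t0 z / (w - z))"

definition circle_arc :: "real \<Rightarrow> real \<Rightarrow> complex set" where
  "circle_arc \<alpha> \<beta> = cis ` {\<alpha>..\<beta>}"

section \<open>Angelesco systems\<close>

text \<open>Systems \<open>\<mu>\<^sub>1, \<dots>, \<mu>\<^sub>r\<close> and multi-indices are functions on \<open>nat\<close>, of which only the values
  on \<open>{1..r}\<close> matter.\<close>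

definition angelesco :: "nat \<Rightarrow> (nat \<Rightarrow> complex measure) \<Rightarrow> (nat \<Rightarrow> complex set) \<Rightarrow> bool" where
  "angelesco r \<mu> \<Gamma> \<longleftrightarrow>
     (\<forall>j\<in>{1..r}. circle_prob (\<mu> j) \<and> infinite (circle_support (\<mu> j)) \<and>
        (\<exists>\<alpha> \<beta>. \<alpha> \<le> \<beta> \<and> \<beta> \<le> \<alpha> + 2 * pi \<and> \<Gamma> j = circle_arc \<alpha> \<beta>) \<and>
        circle_support (\<mu> j) \<subseteq> \<Gamma> j) \<and>
     (\<forall>j\<in>{1..r}. \<forall>k\<in>{1..r}. j \<noteq> k \<longrightarrow> finite (\<Gamma> j \<inter> \<Gamma> k) \<and> card (\<Gamma> j \<inter> \<Gamma> k) \<le> 2)"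

definition arcs_ordered :: "real \<Rightarrow> nat \<Rightarrow> (nat \<Rightarrow> complex set) \<Rightarrow> bool" where
  "arcs_ordered t0 r \<Gamma> \<longleftrightarrow> (\<exists>\<alpha> \<beta> :: nat \<Rightarrow> real.
     (\<forall>j\<in>{1..r}. \<Gamma> j = circle_arc (\<alpha> j) (\<beta> j) \<and> t0 \<le> \<alpha> j \<and> \<alpha> j \<le> \<beta> j \<and> \<beta> j \<le> t0 + 2 * pi) \<and>
     (\<forall>j\<in>{1..<r}. \<beta> j \<le> \<alpha> (Suc j)))"

section \<open>AT systems\<close>

definition chebyshev_on :: "real \<Rightarrow> real \<Rightarrow> (real \<Rightarrow> real) list \<Rightarrow> bool" where
  "chebyshev_on a b us \<longleftrightarrow>
     (\<forall>u\<in>set us. continuous_on {a..b} u) \<and>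
     (\<forall>xs. length xs = length us \<longrightarrow> distinct xs \<longrightarrow> set xs \<subseteq> {a..b} \<longrightarrow>
        Determinant.det (Matrix.mat (length us) (length us) (\<lambda>(j, k). (us ! j) (xs ! k))) \<noteq> 0)"

definition Trig :: "nat \<Rightarrow> (real \<Rightarrow> real) \<Rightarrow> (real \<Rightarrow> real) list" where
  "Trig m f =
     (if even m then
        concat (map (\<lambda>k. [\<lambda>\<theta>. f \<theta> * cos ((2 * real k - 1) / 2 * \<theta>),
                          \<lambda>\<theta>. f \<theta> * sin ((2 * real k - 1) / 2 * \<theta>)]) [1..<Suc (m div 2)])
      else
        f # concat (map (\<lambda>k. [\<lambda>\<theta>. f \<theta> * cos (real k * \<theta>),
                              \<lambda>\<theta>. f \<theta> * sin (real k * \<theta>)]) [1..<Suc ((m - 1) div 2)]))"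

text \<open>Since \<open>\<beta> - \<alpha> \<le> 2\<pi>\<close>, parametrizing the points of the arc by \<open>arg_from \<alpha>\<close> gives the angle
  in \<open>[\<alpha>, \<beta>]\<close> if \<open>\<beta> - \<alpha> < 2\<pi>\<close> and in \<open>[\<alpha>, \<alpha> + 2\<pi>)\<close> if \<open>\<beta> - \<alpha> = 2\<pi>\<close>. Almost everywhere
  nonnegativity of the densities is implicit in the measures being positive, but has to be
  required here because \<open>ennreal\<close> truncates negative values.\<close>

definition AT_system ::
  "nat \<Rightarrow> (nat \<Rightarrow> nat) \<Rightarrow> real \<Rightarrow> real \<Rightarrow> (nat \<Rightarrow> complex measure) \<Rightarrow> bool" where
  "AT_system r n \<alpha> \<beta> \<mu> \<longleftrightarrow> 0 < \<beta> - \<alpha> \<and> \<beta> - \<alpha> \<le> 2 * pi \<and>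
     (\<exists>(\<nu> :: complex measure) (w :: nat \<Rightarrow> real \<Rightarrow> real).
        circle_prob \<nu> \<and> infinite (circle_support \<nu>) \<and> circle_support \<nu> \<subseteq> circle_arc \<alpha> \<beta> \<and>
        (\<forall>j\<in>{1..r}. (\<lambda>x. w j (arg_from \<alpha> x)) \<in> borel_measurable \<nu> \<and>
           (AE x in \<nu>. 0 \<le> w j (arg_from \<alpha> x)) \<and>
           \<mu> j = density \<nu> (\<lambda>x. ennreal (w j (arg_from \<alpha> x)))) \<and>
        chebyshev_on \<alpha> \<beta> (concat (map (\<lambda>j. Trig (n j) (w j)) [1..<Suc r])))"

section \<open>The approximation problem\<close>

definition index_size :: "nat \<Rightarrow> (nat \<Rightarrow> nat) \<Rightarrow> nat" where
  "index_size r n = (\<Sum>j=1..r. n j)"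

definition approx_solution ::
  "real \<Rightarrow> nat \<Rightarrow> (nat \<Rightarrow> nat) \<Rightarrow> (nat \<Rightarrow> complex measure) \<Rightarrow>
     (complex \<Rightarrow> complex) \<Rightarrow> (nat \<Rightarrow> complex \<Rightarrow> complex) \<Rightarrow> bool" where
  "approx_solution t0 r n \<mu> \<phi> \<psi> \<longleftrightarrow>
     (let N = int (index_size r n) in
      \<phi> \<in> half_span t0 (- N) N \<and>
      (\<forall>j\<in>{1..r}.
        (even (N - int (n j)) \<longrightarrow>
           \<psi> j \<in> half_span t0 (- N) N \<and>
           (\<lambda>z. \<phi> z * F_transform (\<mu> j) z + \<psi> j z) \<in> O[at 0](half_pow t0 (int (n j))) \<and>
           (\<lambda>z. \<phi> z * F_transform (\<mu> j) z + \<psi> j z)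
             \<in> O[at_infinity](half_pow t0 (- int (n j) - 2))) \<and>
        (odd (N - int (n j)) \<longrightarrow>
           \<psi> j \<in> half_span t0 (- N + 1) (N - 1) \<and>
           (\<lambda>z. \<phi> z * G_transform t0 (\<mu> j) z + \<psi> j z) \<in> O[at 0](half_pow t0 (int (n j))) \<and>
           (\<lambda>z. \<phi> z * G_transform t0 (\<mu> j) z + \<psi> j z)
             \<in> O[at_infinity](half_pow t0 (- int (n j) - 2)))))"

end

theory Submission
  imports Defs "HOL-Real_Asymp.Real_Asymp"
begin

text \<open>Write \<open>\<phi>(z) = z\<^bsup>-N/2\<^esup> P(z)\<close> with \<open>N = |n|\<close> and \<open>P\<close> a polynomial of degree at most \<open>N\<close>. Comparing
  expansions at \<open>0\<close> and at \<open>\<infinity>\<close>, a suitable \<open>\<psi>\<^sub>j\<close> exists if and only if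
  \<open>\<integral> P(w) w\<^sup>l w\<^bsup>1-(N+n\<^sub>j)/2\<^esup> d\<mu>\<^sub>j = 0\<close> for \<open>0 \<le> l < n\<^sub>j\<close>. These are \<open>N\<close> homogeneous equations for \<open>N + 1\<close>
  coefficients, so a nonzero solution exists, and it is unique up to a factor once a solution with
  \<open>deg P < N\<close> has to vanish. For such \<open>P\<close> the real and imaginary parts \<open>\<tau>\<close> of
  \<open>e\<^bsup>-i(N-1)\<theta>/2\<^esup> P(e\<^bsup>i\<theta>\<^esup>)\<close> are real trigonometric polynomials with at most \<open>N - 1\<close> zeros per period unless
  they vanish identically, and they are orthogonal to every trigonometric polynomial of order \<open>n\<^sub>j\<close>
  with respect to \<open>\<mu>\<^sub>j\<close>. In the Angelesco case this forces \<open>n\<^sub>j\<close> sign changes of \<open>\<tau>\<close> inside the \<open>j\<close>-th arc,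
  hence \<open>N\<close> in total; in the AT case the Chebyshev system contains a function with exactly the sign
  changes of \<open>\<tau>\<close>, whose integral against \<open>\<tau>\<close> cannot vanish.\<close>

section \<open>Homogeneous linear systems\<close>

text \<open>The exponent \<open>1 - (N + n_j)/2\<close> is the sum of \<open>-(N - 1)/2\<close> and
  \<open>-(n_j - 1)/2\<close>: one part centres the frequencies of \<open>P\<close>, the other those
  of the test functions \<open>w^l\<close>, and this is why both sides turn into real trigonometric
  polynomials. If \<open>N + n_j\<close> is odd, their product is antiperiodic and its value at a
  point of the circle depends on the chosen angle; the half-integer power in \<open>G\<close>
  accounts for exactly this. All angles are therefore read off by \<open>arg_from t0\<close>, and
  the arcs must lie as intervals in \<open>[t0, t0 + 2 pi]\<close>. The only possible mismatch is at
  the point of angle \<open>t0\<close>, when it is the right end of the last arc; the condition on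
  \<open>\<mu>_r\<close> removes it. The two cases differ in how a test function with too few sign
  changes is found. Trigonometric polynomials can be padded with factors
  \<open>sin((x - t0)/2)\<close>, which are nonnegative on the whole period. A general Chebyshev
  system has no such factors, so the surplus sign changes are pushed towards an endpoint and a limit
  is taken by compactness.\<close>

lemma ex_nonzero_homogeneous_solution:
  fixes A :: "'i \<Rightarrow> nat \<Rightarrow> 'a :: field"
  assumes "finite I" "card I < d"
  shows "\<exists>c. (\<exists>k<d. c k \<noteq> 0) \<and> (\<forall>i\<in>I. (\<Sum>k<d. c k * A i k) = 0)"
proof -
  obtain h where h: "bij_betw h {..<card I} I"
    using ex_bij_betw_nat_finite[OF assms(1)] by (metis atLeast0LessThan)
  \<comment> \<open>The system is padded with zero rows to a square matrix. Since
    \<open>card I < d\<close>, row \<open>d - 1\<close> is one of them, and expansion along it gives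
    determinant zero.\<close>
  define M where "M = Matrix.mat d d (\<lambda>(i, k). if i < card I then A (h i) k else 0)"
  have M: "M \<in> carrier_mat d d" by (simp add: M_def)
  have "Determinant.det M = (\<Sum>k<d. M $$ (d - 1, k) * cofactor M (d - 1) k)"
    using assms(2) by (intro laplace_expansion_row[OF M]) auto
  also have "\<dots> = 0"
    using assms(2) by (intro sum.neutral) (auto simp: M_def)
  finally have "Determinant.det M = 0" .
  then obtain v where v: "v \<in> carrier_vec d" "v \<noteq> 0\<^sub>v d" "M *\<^sub>v v = 0\<^sub>v d"
    using det_0_iff_vec_prod_zero_field[OF M] by blast
  define c where "c k = vec_index v k" for k
  have "\<exists>k<d. c k \<noteq> 0"
    using v(1,2) unfolding c_def by (metis carrier_vecD eq_vecI index_zero_vec)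
  moreover have "(\<Sum>k<d. c k * A i k) = 0" if "i \<in> I" for i
  proof -
    have "i \<in> h ` {..<card I}" using bij_betw_imp_surj_on[OF h] that by simp
    then obtain e where e: "e < card I" "h e = i" by auto
    have "0 = vec_index (M *\<^sub>v v) e" using v(3) e assms(2) by simp
    also have "\<dots> = (\<Sum>k<d. A i k * c k)"
      using e assms(2) v(1) by (simp add: M_def scalar_prod_def c_def atLeast0LessThan)
    finally show ?thesis by (simp add: mult.commute)
  qed
  ultimately show ?thesis by blast
qed

section \<open>Sign changes\<close>

text \<open>The set \<open>S\<close> consists of those zeros at which \<open>f\<close> changes sign.\<close>

lemma ex_sign_change_set:
  fixes f :: "real \<Rightarrow> real"
  assumes "finite Z" "a \<le> b" "Z \<subseteq> {a<..<b}" "continuous_on {a..b} f"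
    "\<And>x. x \<in> {a<..<b} - Z \<Longrightarrow> f x \<noteq> 0"
  shows "\<exists>S\<subseteq>Z. \<exists>\<sigma>. \<bar>\<sigma>\<bar> = 1 \<and> (\<forall>x\<in>{a..b}. 0 \<le> \<sigma> * f x * (\<Prod>s\<in>S. x - s))"
proof -
  \<comment> \<open>Without interior zeros connectedness fixes the sign on the open interval, and
    continuity carries the weak inequality to the endpoints.\<close>
  have const: "\<exists>\<sigma>. \<bar>\<sigma>\<bar> = 1 \<and> (\<forall>x\<in>{a..b}. 0 \<le> \<sigma> * f x)"
    if "a \<le> b" and cont: "continuous_on {a..b} f" and nz: "\<And>x. x \<in> {a<..<b} \<Longrightarrow> f x \<noteq> 0"
    for a b and f :: "real \<Rightarrow> real"
  proof (cases "a = b")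
    case True
    then show ?thesis
      by (intro exI[of _ "if f a \<ge> 0 then 1 else -1"]) auto
  next
    case False
    with that have ab: "a < b" by simp
    define m where "m = (a + b) / 2"
    have m: "m \<in> {a<..<b}" using ab by (auto simp: m_def)
    define \<sigma> where "\<sigma> = sgn (f m)"
    have fm: "f m \<noteq> 0" using nz[OF m] .
    have inner: "0 \<le> \<sigma> * f x" if x: "x \<in> {a<..<b}" for x
    proof (rule ccontr)
      assume neg: "\<not> 0 \<le> \<sigma> * f x"
      have "connected (f ` {a<..<b})"
        by (rule connected_continuous_image)
           (use that in \<open>auto intro: continuous_on_subset[OF cont]\<close>)
      then have "is_interval (f ` {a<..<b})" by (simp add: is_interval_connected_1)
      then have iv: "y \<in> f ` {a<..<b}" if "u \<in> f ` {a<..<b}" "v \<in> f ` {a<..<b}" "u \<le> y" "y \<le> v" for u v y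
        using that unfolding is_interval_1 by blast
      have "f x < 0 \<and> 0 < f m \<or> f m < 0 \<and> 0 < f x"
        using neg fm by (cases "0 < f m") (auto simp: \<sigma>_def)
      then have "0 \<in> f ` {a<..<b}"
        using iv[of "f x" "f m" 0] iv[of "f m" "f x" 0] m x by auto
      then show False using nz by force
    qed
    have "0 \<le> \<sigma> * f x" if x: "x \<in> {a..b}" for x
    proof -
      have "x \<in> closure {a<..<b}" using ab x by simp
      moreover have "continuous_on (closure {a<..<b}) (\<lambda>x. \<sigma> * f x)"
        using ab cont by (auto intro!: continuous_intros)
      ultimately show ?thesis
        using continuous_ge_on_closure[of "{a<..<b}" "\<lambda>x. \<sigma> * f x" x 0] inner by auto
    qed
    moreover have "\<bar>\<sigma>\<bar> = 1" using fm by (simp add: \<sigma>_def abs_sgn_eq)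
    ultimately show ?thesis by blast
  qed
  show ?thesis
    using assms
  \<comment> \<open>The largest zero \<open>z\<close> is split off: the induction hypothesis covers
    \<open>{a..z}\<close>, which is why \<open>b\<close> must vary, and \<open>const\<close> covers
    \<open>{z..b}\<close>.\<close>
  proof (induction Z arbitrary: b rule: finite_linorder_max_induct)
    case empty
    then show ?case using const[of a b f] by auto
  next
    case (insert z Z)
    have z: "a < z" "z < b" using insert.prems by auto
    have "Z \<subseteq> {a<..<z}" using insert.hyps insert.prems by auto
    moreover have "continuous_on {a..z} f"
      using insert.prems z by (auto intro: continuous_on_subset)
    moreover have "f x \<noteq> 0" if "x \<in> {a<..<z} - Z" for x
      using that insert.prems z by auto
    ultimately obtain S \<sigma> where S: "S \<subseteq> Z" "\<bar>\<sigma>\<bar> = 1"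
      "\<And>x. x \<in> {a..z} \<Longrightarrow> 0 \<le> \<sigma> * f x * (\<Prod>s\<in>S. x - s)"
      using insert.IH[of z] z by (meson less_imp_le)
    have fS: "finite S" using S(1) insert.hyps finite_subset by blast
    have pos: "0 \<le> (\<Prod>s\<in>S. x - s)" if "x \<in> {z..b}" for x
      using S(1) insert.hyps that by (intro prod_nonneg) fastforce
    have "continuous_on {z..b} f"
      using insert.prems z by (auto intro: continuous_on_subset)
    moreover have "f x \<noteq> 0" if "x \<in> {z<..<b}" for x
      using that insert.prems insert.hyps z by (intro insert.prems(4)) fastforce+
    ultimately obtain \<sigma>' where \<sigma>': "\<bar>\<sigma>'\<bar> = 1" "\<And>x. x \<in> {z..b} \<Longrightarrow> 0 \<le> \<sigma>' * f x"
      using const[of z b f] z by auto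
    show ?case
    \<comment> \<open>Equal signs on both sides mean no change at \<open>z\<close>, and
      \<open>S\<close> stays. Otherwise \<open>z\<close> joins \<open>S\<close> and the new overall
      sign is that of the right-hand piece, where all factors \<open>x - s\<close> are
      nonnegative.\<close>
    proof (cases "\<sigma> = \<sigma>'")
      case True
      have "0 \<le> \<sigma> * f x * (\<Prod>s\<in>S. x - s)" if "x \<in> {a..b}" for x
      proof (cases "x \<le> z")
        case True
        then show ?thesis using S(3) that by auto
      next
        case False
        then show ?thesis using \<sigma>'(2)[of x] pos[of x] that \<open>\<sigma> = \<sigma>'\<close> by auto
      qed
      then show ?thesis using S by blast
    next
      case False
      then have \<sigma>eq: "\<sigma> = - \<sigma>'" using S(2) \<sigma>'(1) by linarith
      have zS: "z \<notin> S" using S(1) insert.hyps by auto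
      have "0 \<le> \<sigma>' * f x * (\<Prod>s\<in>insert z S. x - s)" if "x \<in> {a..b}" for x
      proof (cases "x \<le> z")
        case True
        have "0 \<le> (\<sigma> * f x * (\<Prod>s\<in>S. x - s)) * (z - x)"
          using S(3)[of x] that True by (intro mult_nonneg_nonneg[of "\<sigma> * f x * (\<Prod>s\<in>S. x - s)"]) auto
        then show ?thesis using fS zS by (simp add: \<sigma>eq algebra_simps)
      next
        case False
        have "0 \<le> (\<sigma>' * f x) * ((x - z) * (\<Prod>s\<in>S. x - s))"
          using \<sigma>'(2)[of x] pos[of x] that False
          by (intro mult_nonneg_nonneg[of "\<sigma>' * f x"] mult_nonneg_nonneg[of "x - z"]) auto
        then show ?thesis using fS zS by (simp add: algebra_simps)
      qed
      moreover have "insert z S \<subseteq> insert z Z" using S(1) by blast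
      ultimately show ?thesis using \<sigma>'(1) by blast
    qed
  qed
qed

section \<open>Chebyshev systems\<close>

text \<open>The coefficient vector lies in the kernel of the transpose of the matrix in the
  Chebyshev condition, whose determinant is nonzero.\<close>

lemma chebyshev_zero_bound:
  assumes ch: "chebyshev_on a b us" and X: "finite X" "X \<subseteq> {a..b}" "card X = length us"
    and zero: "\<And>x. x \<in> X \<Longrightarrow> (\<Sum>k<length us. c k * (us ! k) x) = 0"
    and k: "k < length us"
  shows "c k = 0"
proof -
  define n where "n = length us"
  define xs where "xs = sorted_list_of_set X"
  have xs: "set xs = X" "distinct xs" "length xs = n"
    using X by (auto simp: xs_def n_def)
  define M where "M = Matrix.mat n n (\<lambda>(j, k). (us ! j) (xs ! k))"
  have M: "M \<in> carrier_mat n n" "transpose_mat M \<in> carrier_mat n n" by (auto simp: M_def)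
  have "Determinant.det M \<noteq> 0"
    using ch xs X unfolding chebyshev_on_def M_def n_def by blast
  then have det: "Determinant.det (transpose_mat M) \<noteq> 0"
    using det_transpose[OF M(1)] by simp
  define v where "v = Matrix.vec n c"
  have v: "v \<in> carrier_vec n" by (simp add: v_def)
  have "transpose_mat M *\<^sub>v v = 0\<^sub>v n"
  proof (rule eq_vecI)
    fix i assume "i < dim_vec (0\<^sub>v n :: real Matrix.vec)"
    then have i: "i < n" by simp
    then have "xs ! i \<in> X" using xs nth_mem by metis
    then show "vec_index (transpose_mat M *\<^sub>v v) i = vec_index (0\<^sub>v n) i"
      using i zero[of "xs ! i"]
      by (simp add: M_def v_def scalar_prod_def n_def atLeast0LessThan mult.commute)
  qed (simp add: M_def)
  then have "v = 0\<^sub>v n"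
    using det det_0_iff_vec_prod_zero_field[OF M(2)] v by blast
  then show ?thesis
    using k unfolding v_def n_def by (metis index_vec index_zero_vec(1))
qed

lemma chebyshev_finite_zeros:
  assumes ch: "chebyshev_on a b us" and nz: "k < length us" "c k \<noteq> 0"
  shows "finite {x \<in> {a..b}. (\<Sum>k<length us. c k * (us ! k) x) = 0}"
proof (rule ccontr)
  assume "infinite {x \<in> {a..b}. (\<Sum>k<length us. c k * (us ! k) x) = 0}"
  then obtain Y where "Y \<subseteq> {x \<in> {a..b}. (\<Sum>k<length us. c k * (us ! k) x) = 0}"
    "finite Y" "card Y = length us"
    using infinite_arbitrarily_large by blast
  then show False using chebyshev_zero_bound[OF ch, of Y c k] nz by blast
qed

lemma chebyshev_continuous:
  assumes "chebyshev_on a b us"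
  shows "continuous_on {a..b} (\<lambda>x. \<Sum>k<length us. c k * (us ! k) x)"
proof -
  have "continuous_on {a..b} (us ! k)" if "k < length us" for k
    using assms that nth_mem unfolding chebyshev_on_def by blast
  then show ?thesis by (intro continuous_intros) auto
qed

lemma chebyshev_ex_vanishing:
  assumes "finite X" "card X < length us"
  shows "\<exists>c. (\<exists>k<length us. c k \<noteq> 0) \<and> (\<forall>x\<in>X. (\<Sum>k<length us. c k * (us ! k) x) = (0::real))"
  by (rule ex_nonzero_homogeneous_solution[OF assms, of "\<lambda>x k. (us ! k) x"])

text \<open>At a zero without a sign change, subtracting a small multiple of a function that is positive
  there and vanishes at the remaining zeros would produce one zero too many.\<close>

lemma chebyshev_sign_change:
  assumes ch: "chebyshev_on a b us" and S: "S \<subseteq> {a<..<b}" "Suc (card S) = length us" "finite S"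
    and c: "\<And>x. x \<in> S \<Longrightarrow> (\<Sum>k<length us. c k * (us ! k) x) = 0"
    and s: "s \<in> S" and d: "d > 0" "{s-d..s+d} \<subseteq> {a<..<b} - (S - {s})"
    and pos: "\<And>x. x \<in> {s-d..s+d} - {s} \<Longrightarrow> 0 < (\<Sum>k<length us. c k * (us ! k) x)"
  shows False
proof -
  define U where "U c x = (\<Sum>k<length us. c k * (us ! k) x)" for c x
  have cont: "continuous_on {a..b} (U c)" for c
    unfolding U_def by (rule chebyshev_continuous[OF ch])
  have lin: "U (\<lambda>k. c k - e * v k) x = U c x - e * U v x" for c v e x
    by (simp add: U_def algebra_simps sum_subtractf sum_distrib_left)
  have bnd: "False" if "finite X" "X \<subseteq> {a..b}" "card X = length us" "\<And>x. x \<in> X \<Longrightarrow> U c x = 0"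
    "U c y \<noteq> 0" for X c y
  proof -
    have "c k = 0" if "k < length us" for k
      using chebyshev_zero_bound[OF ch, of X c k] that
        \<open>finite X\<close> \<open>X \<subseteq> {a..b}\<close> \<open>card X = length us\<close> \<open>\<And>x. x \<in> X \<Longrightarrow> U c x = 0\<close>
      unfolding U_def by blast
    then show False using \<open>U c y \<noteq> 0\<close> unfolding U_def by simp
  qed
  have aS: "a \<notin> S" "a \<in> {a..b}" using S(1) s by force+
  have card1: "Suc (card (S - {s})) = card S" using S(3) s by (rule card_Suc_Diff1)
  \<comment> \<open>The endpoint \<open>a\<close> serves as an additional zero: with
    \<open>S - {s}\<close> it makes \<open>length us - 1\<close> points, so a nonzero
    \<open>v0\<close> vanishing there exists and cannot vanish at \<open>s\<close> as well.\<close>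
  have "card (insert a (S - {s})) < length us"
    using S aS card1 by simp
  then obtain v0 where v0: "\<exists>k<length us. v0 k \<noteq> 0" "\<forall>x\<in>insert a (S - {s}). U v0 x = 0"
    using chebyshev_ex_vanishing[of "insert a (S - {s})" us] S(3) unfolding U_def by blast
  have v0s: "U v0 s \<noteq> 0"
  proof
    assume "U v0 s = 0"
    then have "\<forall>x\<in>insert a S. U v0 x = 0" using v0(2) by blast
    then have "\<forall>k<length us. v0 k = 0"
      using chebyshev_zero_bound[OF ch, of "insert a S" v0] S aS unfolding U_def by fastforce
    then show False using v0(1) by blast
  qed
  define v where "v k = v0 k / U v0 s" for k
  have Uv: "U v x = U v0 x / U v0 s" for x
    unfolding v_def U_def by (simp add: sum_divide_distrib)
  have vs: "U v s = 1" and v0': "\<And>x. x \<in> S - {s} \<Longrightarrow> U v x = 0"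
    using Uv v0s v0(2) by auto
  have p1: "0 < U c (s - d)" and p2: "0 < U c (s + d)"
    using pos[of "s - d"] pos[of "s + d"] d(1) unfolding U_def by auto
  \<comment> \<open>The constant keeps \<open>e * U v\<close> below \<open>U c\<close> at both
    \<open>s - d\<close> and \<open>s + d\<close>; the summand 1 makes the denominator positive and
    the inequality strict.\<close>
  define e where "e = min (U c (s - d)) (U c (s + d)) / (1 + \<bar>U v (s - d)\<bar> + \<bar>U v (s + d)\<bar>)"
  have e: "e > 0" unfolding e_def using p1 p2 by (intro divide_pos_pos) auto
  have eq: "e * (1 + \<bar>U v (s - d)\<bar> + \<bar>U v (s + d)\<bar>) = min (U c (s - d)) (U c (s + d))"
    unfolding e_def by (simp add: add_nonneg_eq_0_iff add_pos_nonneg field_simps)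
  have small: "e * U v y < U c y" if "y = s - d \<or> y = s + d" for y
  proof -
    have "e * U v y \<le> e * \<bar>U v y\<bar>" using e by (intro mult_left_mono) auto
    also have "\<dots> < e * (1 + \<bar>U v (s - d)\<bar> + \<bar>U v (s + d)\<bar>)"
      using e that by (intro mult_strict_left_mono) auto
    also have "\<dots> \<le> U c y" using eq that by auto
    finally show ?thesis .
  qed
  \<comment> \<open>\<open>U g\<close> is negative at \<open>s\<close> and positive at
    \<open>s - d\<close> and \<open>s + d\<close>. Its two new zeros replace the single zero
    \<open>s\<close>, which gives \<open>card S + 1 = length us\<close> zeros, one more than a
    nonzero combination can have.\<close>
  define g where "g k = c k - e * v k" for k
  have Ug: "U g x = U c x - e * U v x" for x unfolding g_def by (rule lin)
  have cs: "U c x = 0" if "x \<in> S" for x using c[OF that] unfolding U_def .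
  have gs: "U g s < 0" using Ug vs cs[OF s] e by simp
  have gd: "0 < U g (s - d)" "0 < U g (s + d)" using small Ug by auto
  have sub: "{s-d..s} \<subseteq> {a..b}" "{s..s+d} \<subseteq> {a..b}"
  proof -
    have "x \<in> {a..b}" if "x \<in> {s-d..s+d}" for x using subsetD[OF d(2) that] by auto
    then show "{s-d..s} \<subseteq> {a..b}" "{s..s+d} \<subseteq> {a..b}" using d(1) by auto
  qed
  obtain z1 where z1: "s - d \<le> z1" "z1 \<le> s" "U g z1 = 0"
    using IVT2'[of "U g" s 0 "s - d"] gs gd d(1) continuous_on_subset[OF cont sub(1)] by auto
  obtain z2 where z2: "s \<le> z2" "z2 \<le> s + d" "U g z2 = 0"
    using IVT'[of "U g" s 0 "s + d"] gs gd d(1) continuous_on_subset[OF cont sub(2)] by auto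
  have zs: "z1 \<noteq> s" "z2 \<noteq> s" using gs z1 z2 by auto
  have zin: "z1 \<in> {a<..<b} - (S - {s})" "z2 \<in> {a<..<b} - (S - {s})"
    using z1 z2 d by (auto simp: subset_eq)
  have "z1 \<noteq> z2" using z1 z2 zs by auto
  show False
  proof (rule bnd[of "insert z1 (insert z2 (S - {s}))" g s])
    show "card (insert z1 (insert z2 (S - {s}))) = length us"
      using \<open>z1 \<noteq> z2\<close> zin zs S card1 by simp
    show "insert z1 (insert z2 (S - {s})) \<subseteq> {a..b}" using zin S(1) by force
    show "U g x = 0" if "x \<in> insert z1 (insert z2 (S - {s}))" for x
      using that z1 z2 Ug cs v0' by auto
  next
    show "finite (insert z1 (insert z2 (S - {s})))" using S(3) by simp
    show "U g s \<noteq> 0" using gs by simp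
  qed
qed

text \<open>The \<open>length us - 1\<close> prescribed zeros exhaust what a nonzero combination can
  have, so there are no others in \<open>{a..b}\<close>, and by \<open>chebyshev_sign_change\<close>
  each of them is a genuine sign change. Hence the set supplied by \<open>ex_sign_change_set\<close>
  is all of \<open>S\<close>.\<close>

lemma chebyshev_sign_pattern_full:
  assumes ch: "chebyshev_on a b us" and ab: "a < b"
    and S: "S \<subseteq> {a<..<b}" "Suc (card S) = length us" "finite S"
  shows "\<exists>c. (\<exists>k<length us. c k \<noteq> 0) \<and>
    (\<forall>x\<in>{a..b}. 0 \<le> (\<Sum>k<length us. c k * (us ! k) x) * (\<Prod>s\<in>S. x - s))"
proof -
  define U where "U c x = (\<Sum>k<length us. c k * (us ! k) x)" for c x
  have scale: "U (\<lambda>k. e * c k) x = e * U c x" for c e x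
    by (simp add: U_def sum_distrib_left mult.assoc)
  obtain c where c: "\<exists>k<length us. c k \<noteq> 0" "\<forall>x\<in>S. U c x = 0"
    using chebyshev_ex_vanishing[of S us] S unfolding U_def by auto
  have nz: "U c x \<noteq> 0" if "x \<in> {a..b} - S" for x
  proof
    assume "U c x = 0"
    then have "\<forall>k<length us. c k = 0"
      using chebyshev_zero_bound[OF ch, of "insert x S" c] S c(2) that unfolding U_def by fastforce
    then show False using c(1) by blast
  qed
  have "continuous_on {a..b} (U c)"
    unfolding U_def by (rule chebyshev_continuous[OF ch])
  then obtain S' \<sigma> where S': "S' \<subseteq> S" "\<bar>\<sigma>\<bar> = 1" and
    sgn: "\<And>x. x \<in> {a..b} \<Longrightarrow> 0 \<le> \<sigma> * U c x * (\<Prod>s\<in>S'. x - s)"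
    using ex_sign_change_set[of S a b "U c"] S ab nz
    by (metis Diff_iff atLeastAtMost_iff greaterThanLessThan_iff less_imp_le)
  have fS': "finite S'" using S' S finite_subset by blast
  have "S \<subseteq> S'"
  proof
    fix s assume s: "s \<in> S"
    show "s \<in> S'"
    proof (rule ccontr)
      assume ns: "s \<notin> S'"
      \<comment> \<open>If \<open>s\<close> is not in \<open>S'\<close>, the product over
        \<open>S'\<close> has constant sign near \<open>s\<close>, and the factor
        \<open>\<rho>\<close> makes the function positive on both sides of \<open>s\<close>: the
        situation that \<open>chebyshev_sign_change\<close> excludes.\<close>
      define \<rho> where "\<rho> = \<sigma> * sgn (\<Prod>t\<in>S'. s - t)"
      have "open ({a<..<b} - (S - {s}))"
        using S by (intro open_Diff finite_imp_closed) auto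
      moreover have "s \<in> {a<..<b} - (S - {s})" using s S by auto
      ultimately obtain d where d: "d > 0" "cball s d \<subseteq> {a<..<b} - (S - {s})"
        using open_contains_cball by blast
      have d2: "{s-d..s+d} \<subseteq> {a<..<b} - (S - {s})" using d by (simp add: cball_eq_atLeastAtMost)
      have same: "sgn (\<Prod>t\<in>S'. x - t) = sgn (\<Prod>t\<in>S'. s - t)" if x: "x \<in> {s-d..s+d}" for x
      proof -
        have "sgn (x - t) = sgn (s - t)" if t: "t \<in> S'" for t
        proof -
          have "t \<notin> {s-d..s+d}" using t S' ns d2 by auto
          then show ?thesis using x by (auto simp: sgn_if)
        qed
        moreover have "sgn (\<Prod>t\<in>S'. y - t) = (\<Prod>t\<in>S'. sgn (y - t))" for y :: real
          by (induction S' rule: infinite_finite_induct) (auto simp: sgn_mult)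
        ultimately show ?thesis by simp
      qed
      show False
      proof (rule chebyshev_sign_change[OF ch S, of "\<lambda>k. \<rho> * c k" s d])
        fix x assume x: "x \<in> {s-d..s+d} - {s}"
        then have xin: "x \<in> {a..b}" "x \<notin> S" using d2 by force+
        then have "U c x \<noteq> 0" "(\<Prod>t\<in>S'. x - t) \<noteq> 0" using nz S' fS' by auto
        then have "0 < \<sigma> * U c x * (\<Prod>s\<in>S'. x - s)"
          using sgn[OF xin(1)] S'(2) by (smt (verit) mult_eq_0_iff)
        then have "0 < \<sigma> * U c x * sgn (\<Prod>s\<in>S'. x - s)"
          by (simp add: zero_less_mult_iff)
        then have "0 < U (\<lambda>k. \<rho> * c k) x"
          using same[of x] x unfolding scale by (simp add: \<rho>_def mult_ac)
        then show "0 < (\<Sum>k<length us. \<rho> * c k * (us ! k) x)" unfolding U_def .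
      next
        fix x assume "x \<in> S"
        then have "U (\<lambda>k. \<rho> * c k) x = 0" using c(2) by (simp add: scale)
        then show "(\<Sum>k<length us. \<rho> * c k * (us ! k) x) = 0" unfolding U_def .
      qed (use s d d2 in auto)
    qed
  qed
  then have "S' = S" using S' by blast
  then have "\<forall>x\<in>{a..b}. 0 \<le> U (\<lambda>k. \<sigma> * c k) x * (\<Prod>s\<in>S. x - s)"
    using sgn by (simp add: scale)
  moreover have "\<exists>k<length us. \<sigma> * c k \<noteq> 0" using c(1) S'(2) by auto
  ultimately show ?thesis unfolding U_def by (intro exI[of _ "\<lambda>k. \<sigma> * c k"] conjI)
qed

text \<open>Bolzano-Weierstrass by successive extraction, one coordinate at a time; it is meant for
  normalized coefficient vectors.\<close>

lemma bounded_family_convergent_subsequence: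
  fixes f :: "nat \<Rightarrow> nat \<Rightarrow> real"
  assumes "\<And>n k. k < d \<Longrightarrow> \<bar>f n k\<bar> \<le> B"
  shows "\<exists>r l. strict_mono r \<and> (\<forall>k<d. (\<lambda>n. f (r n) k) \<longlonglongrightarrow> l k)"
  using assms
proof (induction d)
  case 0
  then show ?case using strict_mono_id by auto
next
  case (Suc d)
  then obtain r l where r: "strict_mono r" "\<forall>k<d. (\<lambda>n. f (r n) k) \<longlonglongrightarrow> l k"
    by (metis less_SucI)
  have "bounded (range (\<lambda>n. f (r n) d))"
    using Suc.prems[of d] by (auto simp: bounded_iff)
  then obtain m r' where r': "strict_mono r'" "((\<lambda>n. f (r n) d) \<circ> r') \<longlonglongrightarrow> m"
    using bounded_imp_convergent_subsequence by blast
  have "(\<lambda>n. f ((r \<circ> r') n) k) \<longlonglongrightarrow> (l(d := m)) k" if "k < Suc d" for k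
  proof (cases "k = d")
    case True
    then show ?thesis using r'(2) by (simp add: o_def)
  next
    case False
    then have "(\<lambda>n. f (r n) k) \<longlonglongrightarrow> l k" using r(2) that by auto
    from LIMSEQ_subseq_LIMSEQ[OF this r'(1)] show ?thesis using False by (simp add: o_def)
  qed
  moreover have "strict_mono (r \<circ> r')" using r(1) r'(1) by (rule strict_mono_o)
  ultimately show ?case by blast
qed

text \<open>If there are fewer points than possible, the missing sign changes are moved into the
  endpoint \<open>b\<close>.\<close>

lemma chebyshev_sign_pattern:
  assumes ch: "chebyshev_on a b us" and ab: "a < b"
    and S: "S \<subseteq> {a<..<b}" "card S < length us" "finite S"
  shows "\<exists>c. (\<exists>k<length us. c k \<noteq> 0) \<and>
    (\<forall>x\<in>{a..b}. 0 \<le> (\<Sum>k<length us. c k * (us ! k) x) * (\<Prod>s\<in>S. x - s))"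
proof -
  define N where "N = length us"
  define K where "K = N - 1 - card S"
  define U where "U c x = (\<Sum>k<length us. c k * (us ! k) x)" for c x
  have scale: "U (\<lambda>k. e * c k) x = e * U c x" for c e x
    by (simp add: U_def sum_distrib_left mult.assoc)
  \<comment> \<open>\<open>m\<close> is the last point of \<open>S\<close>, or \<open>a\<close> if
    there is none; the points \<open>y i\<close> stay strictly between \<open>m\<close> and
    \<open>b\<close> and tend to \<open>b\<close>.\<close>
  define m where "m = Max (insert a S)"
  have m: "a \<le> m" "m < b" "\<And>s. s \<in> S \<Longrightarrow> s \<le> m"
    using S ab by (auto simp: m_def)
  define y where "y i = b - (b - m) / (real i + 2)" for i
  have y: "m < y i" "y i < b" for i
  proof -
    have "(b - m) / (real i + 2) < b - m" "0 < (b - m) / (real i + 2)"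
      using m(2) by (auto simp: divide_less_eq intro!: mult_less_cancel_left_pos[THEN iffD2, of _ 1, simplified])
    then show "m < y i" "y i < b" unfolding y_def by linarith+
  qed
  have ylim: "y \<longlonglongrightarrow> b"
    unfolding y_def by real_asymp
  have "\<exists>c. (\<Sum>k<N. \<bar>c k\<bar>) = 1 \<and> (\<forall>x\<in>{a..y i}. 0 \<le> U c x * (\<Prod>s\<in>S. x - s))" for i
  proof -
    \<comment> \<open>\<open>K\<close> further sign changes are put between \<open>y i\<close> and
      \<open>b\<close> to reach the full number \<open>length us - 1\<close>.\<close>
    have "infinite {y i<..<b}" using y by simp
    then obtain E where E: "finite E" "card E = K" "E \<subseteq> {y i<..<b}"
      using infinite_arbitrarily_large by blast
    have ES: "y i < e" "e < b" if "e \<in> E" for e using that E(3) by auto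
    have disj: "S \<inter> E = {}" using ES(1) y(1)[of i] m(3) by fastforce
    have "S \<union> E \<subseteq> {a<..<b}" using S(1) ES y(1)[of i] m(1) by force
    moreover have "Suc (card (S \<union> E)) = length us"
      using card_Un_disjoint[OF S(3) E(1) disj] E(2) S(2) by (simp add: K_def N_def)
    ultimately obtain c where c: "\<exists>k<N. c k \<noteq> 0"
      "\<And>x. x \<in> {a..b} \<Longrightarrow> 0 \<le> U c x * (\<Prod>s\<in>S\<union>E. x - s)"
      using chebyshev_sign_pattern_full[OF ch ab, of "S \<union> E"] S E unfolding U_def N_def by blast
    define A where "A = (\<Sum>k<N. \<bar>c k\<bar>)"
    have A: "A > 0" unfolding A_def using c(1) by (auto intro!: sum_pos2)
    \<comment> \<open>On \<open>{a..y i}\<close> every extra factor \<open>x - s\<close> is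
      negative, and \<open>(-1) ^ K\<close> undoes this. Division by \<open>A\<close> makes the
      absolute values of the coefficients sum to 1, which keeps the limit nonzero.\<close>
    define c' where "c' k = ((-1) ^ K / A) * c k" for k
    have "(\<Sum>k<N. \<bar>c' k\<bar>) = 1"
      using A by (simp add: c'_def abs_mult power_abs A_def flip: sum_divide_distrib)
    moreover have "0 \<le> U c' x * (\<Prod>s\<in>S. x - s)" if x: "x \<in> {a..y i}" for x
    proof -
      have "(\<Prod>s\<in>E. x - s) = (-1) ^ K * (\<Prod>s\<in>E. s - x)"
        using prod_uminus[of "\<lambda>s. s - x" E] E by simp
      then have "(\<Prod>s\<in>S\<union>E. x - s) = (\<Prod>s\<in>S. x - s) * ((-1) ^ K * (\<Prod>s\<in>E. s - x))"
        using prod.union_disjoint[OF S(3) E(1) disj, of "\<lambda>s. x - s"] by simp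
      then have "0 \<le> ((-1) ^ K * U c x * (\<Prod>s\<in>S. x - s)) * (\<Prod>s\<in>E. s - x)"
        using c(2)[of x] x y[of i] by (simp add: mult_ac)
      moreover have "0 < (\<Prod>s\<in>E. s - x)"
        using E x by (intro prod_pos) force
      ultimately have "0 \<le> (-1) ^ K * U c x * (\<Prod>s\<in>S. x - s)"
        by (simp add: zero_le_mult_iff)
      then have "0 \<le> ((-1) ^ K * U c x * (\<Prod>s\<in>S. x - s)) / A" using A by simp
      then show ?thesis unfolding c'_def scale by simp
    qed
    ultimately show ?thesis by blast
  qed
  then obtain C where C: "\<And>i. (\<Sum>k<N. \<bar>C i k\<bar>) = 1"
    "\<And>i x. x \<in> {a..y i} \<Longrightarrow> 0 \<le> U (C i) x * (\<Prod>s\<in>S. x - s)" by metis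
  have "\<bar>C i k\<bar> \<le> 1" if "k < N" for i k
    using member_le_sum[of k "{..<N}" "\<lambda>k. \<bar>C i k\<bar>"] C(1)[of i] that by auto
  then obtain r c where r: "strict_mono r" "\<And>k. k < N \<Longrightarrow> (\<lambda>i. C (r i) k) \<longlonglongrightarrow> c k"
    using bounded_family_convergent_subsequence[of N C 1] by blast
  have "(\<lambda>i. \<Sum>k<N. \<bar>C (r i) k\<bar>) \<longlonglongrightarrow> (\<Sum>k<N. \<bar>c k\<bar>)"
    using r(2) by (intro tendsto_intros) auto
  then have "(\<Sum>k<N. \<bar>c k\<bar>) = 1" using C(1) by (simp add: LIMSEQ_const_iff)
  then have nz: "\<exists>k<N. c k \<noteq> 0" by (metis (no_types, lifting) abs_zero lessThan_iff sum.neutral zero_neq_one)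
  \<comment> \<open>A fixed \<open>x < b\<close> lies in \<open>{a..y (r i)}\<close> for all large
    \<open>i\<close>, so the inequality passes to the limit; \<open>b\<close> itself is then reached
    by continuity.\<close>
  have inner: "0 \<le> U c x * (\<Prod>s\<in>S. x - s)" if x: "x \<in> {a..<b}" for x
  proof (rule LIMSEQ_le_const)
    show "(\<lambda>i. U (C (r i)) x * (\<Prod>s\<in>S. x - s)) \<longlonglongrightarrow> U c x * (\<Prod>s\<in>S. x - s)"
      unfolding U_def using r(2) by (intro tendsto_intros) (auto simp: N_def)
    have "(\<lambda>i. y (r i)) \<longlonglongrightarrow> b" using LIMSEQ_subseq_LIMSEQ[OF ylim r(1)] by (simp add: o_def)
    then have "\<forall>\<^sub>F i in sequentially. x < y (r i)" using x by (intro order_tendstoD(1)) auto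
    then obtain i0 where "\<And>i. i \<ge> i0 \<Longrightarrow> x < y (r i)" unfolding eventually_sequentially by blast
    then show "\<exists>i0. \<forall>i\<ge>i0. 0 \<le> U (C (r i)) x * (\<Prod>s\<in>S. x - s)"
      using C(2) x by (metis atLeastAtMost_iff atLeastLessThan_iff less_imp_le)
  qed
  have "0 \<le> U c x * (\<Prod>s\<in>S. x - s)" if x: "x \<in> {a..b}" for x
  proof -
    have "x \<in> closure {a..<b}" using ab x by simp
    moreover have "continuous_on (closure {a..<b}) (\<lambda>x. U c x * (\<Prod>s\<in>S. x - s))"
      using ab chebyshev_continuous[OF ch, of c] unfolding U_def by (auto intro!: continuous_intros)
    ultimately show ?thesis
      using continuous_ge_on_closure[of "{a..<b}" "\<lambda>x. U c x * (\<Prod>s\<in>S. x - s)" x 0] inner by auto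
  qed
  then show ?thesis using nz unfolding U_def N_def by (intro exI[of _ c] conjI ballI)
qed

section \<open>Half-integer powers\<close>

lemma sqrt_from_sq: "sqrt_from t0 z ^ 2 = z"
proof -
  have "exp (\<i> / 2 * of_real (arg_from t0 z)) ^ 2 = cis (arg_from t0 z)"
    by (simp add: cis_conv_exp flip: exp_double)
  moreover have "(of_real (sqrt (cmod z)) :: complex) ^ 2 = of_real (cmod z)"
    by (simp flip: of_real_power)
  ultimately show ?thesis
    using arg_from_eq[of z t0] by (simp add: sqrt_from_def power_mult_distrib)
qed

lemma sqrt_from_eq_0_iff [simp]: "sqrt_from t0 z = 0 \<longleftrightarrow> z = 0"
  by (simp add: sqrt_from_def)

lemma half_pow_add: "z \<noteq> 0 \<Longrightarrow> half_pow t0 (m + k) z = half_pow t0 m z * half_pow t0 k z"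
  by (simp add: half_pow_def power_int_add)

lemma half_pow_nonzero [simp]: "z \<noteq> 0 \<Longrightarrow> half_pow t0 m z \<noteq> 0"
  by (simp add: half_pow_def)

lemma half_pow_double: "half_pow t0 (2 * k) z = z powi k"
  using sqrt_from_sq[of t0 z] by (simp add: half_pow_def power_int_mult)

lemma half_pow_double_nat: "half_pow t0 (2 * int k) z = z ^ k"
  by (simp add: half_pow_double)

lemma half_pow_circle:
  assumes "cmod w = 1"
  shows "half_pow t0 m w = cis (of_int m / 2 * arg_from t0 w)"
proof -
  have "sqrt_from t0 w = cis (arg_from t0 w / 2)"
    using assms by (simp add: sqrt_from_def cis_conv_exp)
  then show ?thesis
    by (simp add: half_pow_def cis_power_int mult.commute)
qed

text \<open>The jump of \<open>Arg2pi\<close> does no harm because its sublevel sets are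
  closed.\<close>

lemma arg_from_measurable [measurable]: "arg_from t0 \<in> borel_measurable borel"
proof -
  have [measurable]: "Arg2pi \<in> borel_measurable borel"
    by (rule borel_measurableI_le) (use closed_Arg2pi2pi_le in auto)
  show ?thesis unfolding arg_from_def by measurable
qed

lemma sqrt_from_measurable [measurable]: "sqrt_from t0 \<in> borel_measurable borel"
  unfolding sqrt_from_def by measurable

lemma power_int_measurable: "(\<lambda>w::complex. w powi m) \<in> borel_measurable borel"
proof -
  have p: "(\<lambda>w::complex. w ^ k) \<in> borel_measurable borel" for k
    by (intro borel_measurable_continuous_onI continuous_intros)
  have "(\<lambda>w::complex. inverse (w ^ k)) \<in> borel_measurable borel" for k
    by (rule borel_measurable_inverse[OF p])
  with p show ?thesis
    by (cases "m \<ge> 0") (simp_all add: power_int_def power_inverse)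
qed

lemma half_pow_measurable: "half_pow t0 m \<in> borel_measurable borel"
  unfolding half_pow_def
  by (rule measurable_compose[OF sqrt_from_measurable power_int_measurable])

lemma poly_measurable [measurable]: "poly (P :: complex poly) \<in> borel_measurable borel"
  by (intro borel_measurable_continuous_onI continuous_intros)

lemma poly_eq_sum_atMost:
  fixes P :: "'a :: comm_semiring_1 poly"
  assumes "degree P \<le> d"
  shows "poly P z = (\<Sum>i\<le>d. coeff P i * z ^ i)"
  unfolding poly_altdef using assms
  by (intro sum.mono_neutral_left) (auto simp: coeff_eq_0)

text \<open>Neighbouring exponents differ by 1, so once \<open>z^(a/2)\<close> is factored out only
  integer powers remain. The branch enters through this one factor, and the rest concerns
  polynomials.\<close>

lemma half_span_iff_poly:
  "f \<in> half_span t0 a (a + 2 * int d) \<longleftrightarrow>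
    (\<exists>Q. degree Q \<le> d \<and> (\<forall>z. z \<noteq> 0 \<longrightarrow> f z = half_pow t0 a z * poly Q z))"
proof -
  have set_eq: "{m. a \<le> m \<and> m \<le> a + 2 * int d \<and> even (m - a)} = (\<lambda>i. a + 2 * int i) ` {..d}"
  proof (intro equalityI subsetI)
    fix m assume "m \<in> {m. a \<le> m \<and> m \<le> a + 2 * int d \<and> even (m - a)}"
    then have "m = a + 2 * int (nat ((m - a) div 2))" "nat ((m - a) div 2) \<in> {..d}" by auto
    then show "m \<in> (\<lambda>i. a + 2 * int i) ` {..d}" by blast
  qed auto
  have sum_eq: "(\<Sum>m | a \<le> m \<and> m \<le> a + 2 * int d \<and> even (m - a). c m * half_pow t0 m z) =
      half_pow t0 a z * (\<Sum>i\<le>d. c (a + 2 * int i) * z ^ i)" if "z \<noteq> 0" for c z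
    unfolding set_eq using that
    by (subst sum.reindex)
       (auto simp: inj_on_def half_pow_add half_pow_double_nat sum_distrib_left mult.left_commute)
  show ?thesis
  proof
    assume "f \<in> half_span t0 a (a + 2 * int d)"
    then obtain c where c: "\<And>z. z \<noteq> 0 \<Longrightarrow>
        f z = (\<Sum>m | a \<le> m \<and> m \<le> a + 2 * int d \<and> even (m - a). c m * half_pow t0 m z)"
      unfolding half_span_def by blast
    define Q where "Q = (\<Sum>i\<le>d. monom (c (a + 2 * int i)) i)"
    have "degree Q \<le> d" unfolding Q_def
      by (intro degree_sum_le) (auto intro: order.trans[OF degree_monom_le])
    moreover have "poly Q z = (\<Sum>i\<le>d. c (a + 2 * int i) * z ^ i)" for z
      by (simp add: Q_def poly_sum poly_monom)
    ultimately show "\<exists>Q. degree Q \<le> d \<and> (\<forall>z. z \<noteq> 0 \<longrightarrow> f z = half_pow t0 a z * poly Q z)"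
      using c sum_eq by auto
  next
    assume "\<exists>Q. degree Q \<le> d \<and> (\<forall>z. z \<noteq> 0 \<longrightarrow> f z = half_pow t0 a z * poly Q z)"
    then obtain Q where Q: "degree Q \<le> d" "\<And>z. z \<noteq> 0 \<Longrightarrow> f z = half_pow t0 a z * poly Q z"
      by blast
    define c where "c m = coeff Q (nat ((m - a) div 2))" for m
    have "f z = (\<Sum>m | a \<le> m \<and> m \<le> a + 2 * int d \<and> even (m - a). c m * half_pow t0 m z)"
      if "z \<noteq> 0" for z
      using sum_eq[OF that, of c] Q(2)[OF that] poly_eq_sum_atMost[OF Q(1)] by (simp add: c_def)
    then show "f \<in> half_span t0 a (a + 2 * int d)" unfolding half_span_def by blast
  qed
qed

section \<open>Asymptotics of polynomials\<close>

lemma bigo_tendsto_0: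
  assumes "f \<in> O[F](g)" "(g \<longlongrightarrow> 0) F"
  shows "(f \<longlongrightarrow> 0) F"
proof -
  obtain c where "\<forall>\<^sub>F x in F. norm (f x) \<le> c * norm (g x)"
    using assms(1) by (elim landau_o.bigE)
  moreover have "((\<lambda>x. c * norm (g x)) \<longlongrightarrow> 0) F"
    using assms(2) by (intro tendsto_mult_right_zero tendsto_norm_zero)
  ultimately show ?thesis by (rule Lim_null_comparison)
qed

text \<open>The limit at 0 kills the constant term, and division by \<open>z\<close> lowers the
  order by one.\<close>

lemma poly_bigo_at_0:
  fixes E :: "complex poly"
  assumes "poly E \<in> O[at 0](\<lambda>z. z ^ n)" "k < n"
  shows "coeff E k = 0"
  using assms
proof (induction n arbitrary: E k)
  case 0
  from 0(2) show ?case by simp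
next
  case (Suc n)
  have "((\<lambda>z::complex. z ^ Suc n) \<longlongrightarrow> 0) (at 0)"
    by (rule tendsto_eq_rhs[OF tendsto_power[OF tendsto_ident_at]]) simp
  with Suc.prems(1) have "(poly E \<longlongrightarrow> 0) (at 0)" by (rule bigo_tendsto_0)
  moreover have "(poly E \<longlongrightarrow> poly E 0) (at 0)"
    by (intro tendsto_intros)
  ultimately have "poly E 0 = 0" using tendsto_unique[OF at_neq_bot] by blast
  then obtain E' where E': "E = pCons 0 E'" by (cases E) auto
  have "(\<lambda>z. z * poly E' z) \<in> O[at 0](\<lambda>z. z * z ^ n)" using Suc.prems(1) E' by simp
  then have "poly E' \<in> O[at 0](\<lambda>z. z ^ n)"
    by (subst (asm) landau_o.big.mult_cancel_left) (auto simp: eventually_at intro: exI[of _ 1])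
  then show ?case using Suc.IH[of E'] Suc.prems(2) E' by (cases k) auto
qed

text \<open>Divided by \<open>z ^ degree E\<close>, the polynomial tends to its leading coefficient,
  but for \<open>a \<le> degree E\<close> the bound makes the quotient O(1/z). The integer exponent
  lets \<open>a = 0\<close> mean decay like 1/z, which forces \<open>E = 0\<close>.\<close>

lemma poly_bigo_at_infinity:
  fixes E :: "complex poly"
  assumes "poly E \<in> O[at_infinity](\<lambda>z. z powi (int a - 1))" "a \<le> k"
  shows "coeff E k = 0"
proof (rule ccontr)
  assume "coeff E k \<noteq> 0"
  then have d: "a \<le> degree E" using assms(2) le_degree by (meson order.trans)
  define d where "d = degree E - a"
  have "(\<lambda>z. poly E z / z ^ degree E) \<in> O[at_infinity](\<lambda>z. z powi (int a - 1) / z ^ degree E)"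
    unfolding divide_inverse using assms(1) by (rule landau_o.big.mult_right)
  also have "(\<lambda>z::complex. z powi (int a - 1) / z ^ degree E) \<in> O[at_infinity](\<lambda>z. inverse z)"
  proof (rule bigoI[of _ 1])
    have "cmod (z powi (int a - 1) / z ^ degree E) \<le> cmod (inverse z)" if z: "cmod z \<ge> 1" for z
    proof -
      have z0: "z \<noteq> 0" using z by auto
      have "z powi (int a - 1) / z ^ degree E = inverse z * inverse (z ^ d)"
        using d z0 by (simp add: d_def power_int_diff field_simps flip: power_add)
      moreover have "cmod (inverse (z ^ d)) \<le> 1"
        using z by (simp add: norm_inverse norm_power inverse_le_1_iff)
      ultimately show ?thesis
        by (simp add: norm_mult mult_left_le)
    qed
    then show "\<forall>\<^sub>F z in at_infinity. cmod (z powi (int a - 1) / z ^ degree E) \<le> 1 * cmod (inverse z)"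
      by (auto simp: eventually_at_infinity intro!: exI[of _ 1])
  qed
  finally have "((\<lambda>z. poly E z / z ^ degree E) \<longlongrightarrow> 0) at_infinity"
    by (rule bigo_tendsto_0) (rule tendsto_inverse_0)
  then have "lead_coeff E = 0"
    using poly_divide_tendsto_aux[of E] tendsto_unique[OF trivial_limit_at_infinity] by blast
  then show False using \<open>coeff E k \<noteq> 0\<close> by simp
qed

section \<open>Cauchy transforms\<close>

lemma circle_prob_space:
  assumes "circle_prob M"
  shows "space M = sphere 0 1"
proof -
  have "space M = space (restrict_space borel (sphere (0::complex) 1))"
    using assms unfolding circle_prob_def by (metis sets_eq_imp_space_eq)
  then show ?thesis by (simp add: space_restrict_space)
qed

lemma circle_prob_measurable:
  assumes "circle_prob M" "f \<in> borel_measurable borel"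
  shows "f \<in> borel_measurable M"
proof -
  have "f \<in> borel_measurable (restrict_space borel (sphere 0 1))"
    using assms(2) by (rule measurable_restrict_space1)
  then show ?thesis
    using assms(1) unfolding circle_prob_def by (metis measurable_cong_sets)
qed

lemma circle_prob_integrable:
  fixes f :: "complex \<Rightarrow> 'b :: {banach, second_countable_topology}"
  assumes M: "circle_prob M" and f: "f \<in> borel_measurable borel"
    and B: "\<And>w. cmod w = 1 \<Longrightarrow> norm (f w) \<le> B"
  shows "integrable M f"
proof -
  interpret prob_space M using M by (simp add: circle_prob_def)
  show ?thesis
    by (rule integrable_const_bound[of _ B])
       (use B circle_prob_measurable[OF M f] circle_prob_space[OF M] in \<open>auto simp: dist_norm\<close>)
qed

lemma circle_prob_integral_norm_bound:
  fixes f :: "complex \<Rightarrow> complex"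
  assumes M: "circle_prob M" and f: "f \<in> borel_measurable borel"
    and B: "\<And>w. cmod w = 1 \<Longrightarrow> norm (f w) \<le> B"
  shows "norm (LINT w|M. f w) \<le> B"
proof -
  interpret prob_space M using M by (simp add: circle_prob_def)
  have "norm (LINT w|M. f w) \<le> (LINT w|M. norm (f w))"
    by (rule integral_norm_bound)
  also have "\<dots> \<le> (LINT w|M. B)"
    using circle_prob_integrable[OF M f B] B circle_prob_space[OF M]
    by (intro integral_mono) auto
  finally show ?thesis by (simp add: prob_space)
qed

definition cauchy_transform :: "complex measure \<Rightarrow> (complex \<Rightarrow> complex) \<Rightarrow> complex \<Rightarrow> complex" where
  "cauchy_transform M h z = (LINT w|M. h w / (w - z))"

text \<open>A class closed under products whose members are integrable against every probability on
  the circle. The bound is asked on the circle only, since polynomials and half powers are unbounded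
  in the plane.\<close>

definition circle_bounded :: "(complex \<Rightarrow> complex) \<Rightarrow> bool" where
  "circle_bounded h \<longleftrightarrow> h \<in> borel_measurable borel \<and> (\<exists>B. \<forall>w. cmod w = 1 \<longrightarrow> cmod (h w) \<le> B)"

lemma circle_bounded_mult:
  assumes "circle_bounded f" "circle_bounded h"
  shows "circle_bounded (\<lambda>w. f w * h w)"
proof -
  from assms obtain A B where AB: "\<And>w. cmod w = 1 \<Longrightarrow> cmod (f w) \<le> A"
    "\<And>w. cmod w = 1 \<Longrightarrow> cmod (h w) \<le> B" unfolding circle_bounded_def by blast
  have "cmod (f w * h w) \<le> A * B" if "cmod w = 1" for w
    unfolding norm_mult
    by (intro mult_mono AB that order.trans[OF norm_ge_zero AB(1)[OF that]]) simp
  then show ?thesis using assms unfolding circle_bounded_def by (auto intro: borel_measurable_times)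
qed

lemma circle_bounded_power_int: "circle_bounded (\<lambda>w. w powi m)"
  unfolding circle_bounded_def
proof
  show "(\<lambda>w::complex. w powi m) \<in> borel_measurable borel"
    by (rule power_int_measurable)
qed (auto simp: norm_power_int intro!: exI[of _ 1])

lemma circle_bounded_half_pow: "circle_bounded (half_pow t0 m)"
  unfolding circle_bounded_def
  by (intro conjI half_pow_measurable exI[of _ 1]) (simp add: half_pow_circle)

lemma circle_bounded_poly: "circle_bounded (poly P)"
proof -
  have "compact (poly P ` sphere 0 1)"
    by (intro compact_continuous_image continuous_intros) auto
  then have "bounded (poly P ` sphere 0 1)" by (rule compact_imp_bounded)
  then obtain B where "\<And>w. w \<in> sphere 0 1 \<Longrightarrow> cmod (poly P w) \<le> B"
    unfolding bounded_iff by blast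
  then show ?thesis unfolding circle_bounded_def
    by (intro conjI poly_measurable exI[of _ B]) simp
qed

lemma circle_bounded_const: "circle_bounded (\<lambda>_. c)"
  unfolding circle_bounded_def by auto

lemma circle_bounded_cauchy_kernel:
  assumes "circle_bounded h" "cmod z \<noteq> 1"
  shows "circle_bounded (\<lambda>w. h w / (w - z))"
proof -
  have "circle_bounded (\<lambda>w. inverse (w - z))"
    unfolding circle_bounded_def
  proof (intro conjI exI allI impI)
    fix w :: complex assume w: "cmod w = 1"
    have "\<bar>1 - cmod z\<bar> \<le> cmod (w - z)" using norm_triangle_ineq3[of w z] w by simp
    then show "cmod (inverse (w - z)) \<le> inverse \<bar>1 - cmod z\<bar>"
      using assms(2) by (auto simp: norm_inverse intro!: le_imp_inverse_le)
  qed simp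
  from circle_bounded_mult[OF assms(1) this] show ?thesis by (simp add: field_simps)
qed

lemma circle_bounded_integrable: "circle_prob M \<Longrightarrow> circle_bounded h \<Longrightarrow> integrable M h"
  unfolding circle_bounded_def using circle_prob_integrable by blast

lemma cauchy_transform_cong:
  assumes "circle_prob M" "\<And>w. cmod w = 1 \<Longrightarrow> g w = h w"
  shows "cauchy_transform M g z = cauchy_transform M h z"
  unfolding cauchy_transform_def
  using assms by (intro Bochner_Integration.integral_cong) (auto simp: circle_prob_space)

lemma cauchy_transform_bound:
  assumes M: "circle_prob M" and h: "circle_bounded h"
  obtains B where "\<And>z. cmod z \<noteq> 1 \<Longrightarrow> cmod (cauchy_transform M h z) \<le> B / \<bar>1 - cmod z\<bar>"
proof -
  obtain B where B: "\<And>w. cmod w = 1 \<Longrightarrow> cmod (h w) \<le> B"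
    using h unfolding circle_bounded_def by blast
  have "cmod (cauchy_transform M h z) \<le> B / \<bar>1 - cmod z\<bar>" if z: "cmod z \<noteq> 1" for z
    unfolding cauchy_transform_def
  proof (rule circle_prob_integral_norm_bound[OF M])
    show "(\<lambda>w. h w / (w - z)) \<in> borel_measurable borel"
      using circle_bounded_cauchy_kernel[OF h z] unfolding circle_bounded_def by blast
    fix w :: complex assume w: "cmod w = 1"
    have "\<bar>1 - cmod z\<bar> \<le> cmod (w - z)" using norm_triangle_ineq3[of w z] w by simp
    then show "cmod (h w / (w - z)) \<le> B / \<bar>1 - cmod z\<bar>"
      using B[OF w] z order.trans[OF norm_ge_zero B[OF w]]
      unfolding norm_divide by (intro frac_le) auto
  qed
  then show thesis using that by blast
qed

lemma cauchy_transform_bigo_0: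
  assumes "circle_prob M" "circle_bounded h"
  shows "cauchy_transform M h \<in> O[at 0](\<lambda>_. 1)"
proof -
  obtain B where B: "\<And>z. cmod z \<noteq> 1 \<Longrightarrow> cmod (cauchy_transform M h z) \<le> B / \<bar>1 - cmod z\<bar>"
    using cauchy_transform_bound[OF assms] by blast
  have B0: "0 \<le> B" using B[of 0] order.trans[OF norm_ge_zero] by fastforce
  have "cmod (cauchy_transform M h z) \<le> 2 * B" if "cmod z < 1/2" for z
  proof -
    have "cmod (cauchy_transform M h z) \<le> B / \<bar>1 - cmod z\<bar>" using that by (intro B) auto
    also have "\<dots> \<le> B / (1/2)" using that B0 by (intro divide_left_mono) auto
    finally show ?thesis by simp
  qed
  then show ?thesis
    by (intro bigoI[of _ "2 * B"]) (auto simp: eventually_at dist_norm intro!: exI[of _ "1/2"])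
qed

lemma cauchy_transform_bigo_infinity:
  assumes "circle_prob M" "circle_bounded h"
  shows "cauchy_transform M h \<in> O[at_infinity](\<lambda>z. inverse z)"
proof -
  obtain B where B: "\<And>z. cmod z \<noteq> 1 \<Longrightarrow> cmod (cauchy_transform M h z) \<le> B / \<bar>1 - cmod z\<bar>"
    using cauchy_transform_bound[OF assms] by blast
  have B0: "0 \<le> B" using B[of 0] order.trans[OF norm_ge_zero] by fastforce
  have "cmod (cauchy_transform M h z) \<le> 2 * B * cmod (inverse z)" if z: "cmod z \<ge> 2" for z
  proof -
    have "cmod (cauchy_transform M h z) \<le> B / \<bar>1 - cmod z\<bar>" using z by (intro B) auto
    also have "\<dots> \<le> B / (cmod z / 2)" using z B0 by (intro frac_le) auto
    also have "\<dots> = 2 * B * cmod (inverse z)" using z unfolding norm_inverse by (simp add: field_simps)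
    finally show ?thesis .
  qed
  then show ?thesis
    by (intro bigoI[of _ "2 * B"]) (auto simp: eventually_at_infinity intro!: exI[of _ 2])
qed

text \<open>This integrates \<open>z / (w - z) = w / (w - z) - 1\<close>.\<close>

lemma cauchy_transform_shift:
  assumes M: "circle_prob M" and h: "circle_bounded h" and z: "cmod z \<noteq> 1"
  shows "z * cauchy_transform M h z = cauchy_transform M (\<lambda>w. w * h w) z - (LINT w|M. h w)"
proof -
  have wh: "circle_bounded (\<lambda>w. w * h w)"
    using circle_bounded_mult[OF circle_bounded_power_int[of 1] h] by simp
  have "cauchy_transform M (\<lambda>w. w * h w) z - (LINT w|M. h w) = (LINT w|M. w * h w / (w - z) - h w)"
    unfolding cauchy_transform_def
    by (intro Bochner_Integration.integral_diff[symmetric] circle_bounded_integrable[OF M]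
        circle_bounded_cauchy_kernel wh h z)
  also have "\<dots> = (LINT w|M. z * (h w / (w - z)))"
  proof (intro Bochner_Integration.integral_cong refl)
    fix w assume "w \<in> space M"
    then have "w - z \<noteq> 0" using z by (auto simp: circle_prob_space[OF M])
    then show "w * h w / (w - z) - h w = z * (h w / (w - z))"
      by (simp add: divide_simps) (simp add: algebra_simps)
  qed
  also have "\<dots> = z * cauchy_transform M h z"
    unfolding cauchy_transform_def by (rule integral_mult_right_zero)
  finally show ?thesis by simp
qed

text \<open>Each multiplication by \<open>z\<close> costs a moment, and these collect in a
  polynomial. The bound on \<open>Q\<close> is put on coefficients and not on the degree, so that
  \<open>k = 0\<close> yields \<open>Q = 0\<close>.\<close>

lemma cauchy_transform_shift_power:
  assumes M: "circle_prob M" and h: "circle_bounded h"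
  shows "\<exists>Q. (\<forall>i\<ge>k. coeff Q i = 0) \<and> (\<forall>z. cmod z \<noteq> 1 \<longrightarrow>
    z ^ k * cauchy_transform M h z = cauchy_transform M (\<lambda>w. w ^ k * h w) z + poly Q z)"
proof (induction k)
  case 0
  then show ?case by (intro exI[of _ 0]) auto
next
  case (Suc k)
  then obtain Q where Q: "\<forall>i\<ge>k. coeff Q i = 0" "\<And>z. cmod z \<noteq> 1 \<Longrightarrow>
    z ^ k * cauchy_transform M h z = cauchy_transform M (\<lambda>w. w ^ k * h w) z + poly Q z" by blast
  define m where "m = (LINT w|M. w ^ k * h w)"
  have b: "circle_bounded (\<lambda>w. w ^ k * h w)"
    using circle_bounded_mult[OF circle_bounded_power_int[of "int k"] h] by simp
  have "z ^ Suc k * cauchy_transform M h z =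
      cauchy_transform M (\<lambda>w. w ^ Suc k * h w) z + poly (pCons (- m) Q) z" if z: "cmod z \<noteq> 1" for z
  proof -
    have "z ^ Suc k * cauchy_transform M h z =
        z * cauchy_transform M (\<lambda>w. w ^ k * h w) z + z * poly Q z"
      using Q(2)[OF z] by (simp add: algebra_simps)
    then show ?thesis
      using cauchy_transform_shift[OF M b z] by (simp add: m_def mult.assoc)
  qed
  moreover have "\<forall>i\<ge>Suc k. coeff (pCons (- m) Q) i = 0"
    using Q(1) by (auto simp: coeff_pCons split: nat.split)
  ultimately show ?case by blast
qed

text \<open>The polynomial \<open>R\<close> is \<open>\<integral> g(w) (z\<^sup>a w\<^sup>-\<^sup>a P(w) - P(z)) / (w - z) d\<mu>(w)\<close>.\<close>

lemma cauchy_transform_numerator: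
  assumes M: "circle_prob M" and g: "circle_bounded g" and P: "degree P \<le> N" and a: "a \<le> N"
  shows "\<exists>R. (\<forall>i\<ge>N. coeff R i = 0) \<and> (\<forall>z. cmod z \<noteq> 1 \<longrightarrow>
    poly P z * cauchy_transform M g z + poly R z =
    z ^ a * cauchy_transform M (\<lambda>w. w powi (- int a) * (poly P w * g w)) z)"
proof -
  let ?C = "cauchy_transform M"
  have b: "circle_bounded (\<lambda>w. w powi m * g w)" for m
    by (rule circle_bounded_mult[OF circle_bounded_power_int g])
  \<comment> \<open>By linearity the monomials of \<open>P\<close> suffice. For
    \<open>a \<le> i\<close> the surplus \<open>z ^ (i - a)\<close> is moved inside the transform,
    for \<open>i < a\<close> the missing power \<open>z ^ (a - i)\<close>. Either way the correction
    has no coefficients from index \<open>max i a \<le> N\<close> on.\<close>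
  have mono: "\<exists>R. (\<forall>l\<ge>N. coeff R l = 0) \<and> (\<forall>z. cmod z \<noteq> 1 \<longrightarrow>
      z ^ i * ?C g z + poly R z = z ^ a * ?C (\<lambda>w. w powi (int i - int a) * g w) z)" if i: "i \<le> N" for i
  proof (cases "a \<le> i")
    case True
    obtain Q where Q: "\<forall>l\<ge>i - a. coeff Q l = 0" "\<And>z. cmod z \<noteq> 1 \<Longrightarrow>
      z ^ (i - a) * ?C g z = ?C (\<lambda>w. w ^ (i - a) * g w) z + poly Q z"
      using cauchy_transform_shift_power[OF M g] by blast
    define R where "R = - (monom 1 a * Q)"
    have "coeff R l = 0" if "l \<ge> N" for l
      using Q(1) that i by (simp add: R_def coeff_monom_mult)
    moreover have "z ^ i * ?C g z + poly R z = z ^ a * ?C (\<lambda>w. w powi (int i - int a) * g w) z"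
      if z: "cmod z \<noteq> 1" for z
    proof -
      have "z ^ i = z ^ a * z ^ (i - a)" using True by (simp flip: power_add)
      moreover have "int i - int a = int (i - a)" using True by simp
      ultimately show ?thesis
        using Q(2)[OF z] by (simp add: R_def poly_monom algebra_simps del: of_nat_diff)
    qed
    ultimately show ?thesis by blast
  next
    case False
    let ?h = "\<lambda>w. w powi (int i - int a) * g w"
    obtain Q where Q: "\<forall>l\<ge>a - i. coeff Q l = 0" "\<And>z. cmod z \<noteq> 1 \<Longrightarrow>
      z ^ (a - i) * ?C ?h z = ?C (\<lambda>w. w ^ (a - i) * ?h w) z + poly Q z"
      using cauchy_transform_shift_power[OF M b] by blast
    define R where "R = monom 1 i * Q"
    have "coeff R l = 0" if "l \<ge> N" for l
      using Q(1) that a False by (simp add: R_def coeff_monom_mult)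
    moreover have "z ^ i * ?C g z + poly R z = z ^ a * ?C ?h z" if z: "cmod z \<noteq> 1" for z
    proof -
      have "?C (\<lambda>w. w ^ (a - i) * ?h w) z = ?C g z"
      proof (rule cauchy_transform_cong[OF M])
        fix w :: complex assume "cmod w = 1"
        then have "w \<noteq> 0" by auto
        then have "w ^ (a - i) * w powi (int i - int a) = w powi (int (a - i) + (int i - int a))"
          by (subst power_int_add) auto
        also have "\<dots> = 1" using False by simp
        finally show "w ^ (a - i) * ?h w = g w" by (simp flip: mult.assoc)
      qed
      moreover have "z ^ a = z ^ i * z ^ (a - i)" using False by (simp flip: power_add)
      ultimately show ?thesis
        using Q(2)[OF z] by (simp add: R_def poly_monom algebra_simps)
    qed
    ultimately show ?thesis by blast
  qed
  then obtain R where R: "\<And>i l. i \<le> N \<Longrightarrow> l \<ge> N \<Longrightarrow> coeff (R i) l = 0"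
    "\<And>i z. i \<le> N \<Longrightarrow> cmod z \<noteq> 1 \<Longrightarrow>
      z ^ i * ?C g z + poly (R i) z = z ^ a * ?C (\<lambda>w. w powi (int i - int a) * g w) z" by metis
  define R' where "R' = (\<Sum>i\<le>N. Polynomial.smult (coeff P i) (R i))"
  have "coeff R' l = 0" if "l \<ge> N" for l
    using R(1) that by (simp add: R'_def coeff_sum)
  moreover have "poly P z * ?C g z + poly R' z =
      z ^ a * ?C (\<lambda>w. w powi (- int a) * (poly P w * g w)) z" if z: "cmod z \<noteq> 1" for z
  proof -
    have "poly P z * ?C g z + poly R' z = (\<Sum>i\<le>N. coeff P i * (z ^ i * ?C g z + poly (R i) z))"
      by (simp add: R'_def poly_sum poly_eq_sum_atMost[OF P] sum_distrib_right distrib_left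
          sum.distrib mult.assoc)
    also have "\<dots> = (\<Sum>i\<le>N. coeff P i * (z ^ a * ?C (\<lambda>w. w powi (int i - int a) * g w) z))"
      using R(2) z by simp
    also have "\<dots> = z ^ a * (\<Sum>i\<le>N. coeff P i * ?C (\<lambda>w. w powi (int i - int a) * g w) z)"
      by (simp add: sum_distrib_left mult_ac)
    also have "(\<Sum>i\<le>N. coeff P i * ?C (\<lambda>w. w powi (int i - int a) * g w) z) =
        (LINT w|M. (\<Sum>i\<le>N. coeff P i * (w powi (int i - int a) * g w / (w - z))))"
      unfolding cauchy_transform_def
      by (subst Bochner_Integration.integral_sum)
         (simp_all only: integral_mult_right_zero,
          intro integrable_mult_right circle_bounded_integrable[OF M] circle_bounded_cauchy_kernel b z)
    also have "\<dots> = ?C (\<lambda>w. w powi (- int a) * (poly P w * g w)) z"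
      unfolding cauchy_transform_def
    proof (intro Bochner_Integration.integral_cong refl)
      fix w assume "w \<in> space M"
      then have w: "w \<noteq> 0" by (auto simp: circle_prob_space[OF M])
      then have "w powi (int i - int a) = w powi (- int a) * w ^ i" for i
        by (simp add: power_int_diff power_int_minus field_simps)
      then show "(\<Sum>i\<le>N. coeff P i * (w powi (int i - int a) * g w / (w - z))) =
          w powi (- int a) * (poly P w * g w) / (w - z)"
        by (simp add: poly_eq_sum_atMost[OF P] sum_distrib_left sum_distrib_right
            sum_divide_distrib mult_ac)
    qed
    finally show ?thesis .
  qed
  ultimately show ?thesis by blast
qed

text \<open>A Taylor expansion at 0 with exact remainder, from iterating
  \<open>1 / (w - z) = 1 / w + z / (w (w - z))\<close>. It identifies the integrals of
  \<open>h\<close> against \<open>w powi (- l - 1)\<close> as the Taylor coefficients of the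
  transform.\<close>

lemma cauchy_transform_expand:
  assumes M: "circle_prob M" and h: "circle_bounded h" and z: "cmod z \<noteq> 1"
  shows "cauchy_transform M h z = (\<Sum>l<n. (LINT w|M. h w * w powi (- int l - 1)) * z ^ l) +
    z ^ n * cauchy_transform M (\<lambda>w. w powi (- int n) * h w) z"
proof (induction n)
  case (Suc n)
  have b: "circle_bounded (\<lambda>w. w powi m * h w)" for m
    by (rule circle_bounded_mult[OF circle_bounded_power_int h])
  have "z * cauchy_transform M (\<lambda>w. w powi (- int (Suc n)) * h w) z =
     cauchy_transform M (\<lambda>w. w * (w powi (- int (Suc n)) * h w)) z -
       (LINT w|M. w powi (- int (Suc n)) * h w)"
    by (rule cauchy_transform_shift[OF M b z])
  also have "cauchy_transform M (\<lambda>w. w * (w powi (- int (Suc n)) * h w)) z =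
      cauchy_transform M (\<lambda>w. w powi (- int n) * h w) z"
  proof (rule cauchy_transform_cong[OF M])
    fix w :: complex assume "cmod w = 1"
    then have "w \<noteq> 0" by auto
    then have "w * w powi (- int (Suc n)) = w powi (- int n)"
      using power_int_add[of w 1 "- int (Suc n)"] by simp
    then show "w * (w powi (- int (Suc n)) * h w) = w powi (- int n) * h w"
      by (simp flip: mult.assoc)
  qed
  also have "(LINT w|M. w powi (- int (Suc n)) * h w) = (LINT w|M. h w * w powi (- int n - 1))"
  proof -
    have "- int (Suc n) = - int n - 1" by simp
    then show ?thesis by (simp only: mult.commute)
  qed
  finally have st: "z * cauchy_transform M (\<lambda>w. w powi (- int (Suc n)) * h w) z =
      cauchy_transform M (\<lambda>w. w powi (- int n) * h w) z - (LINT w|M. h w * w powi (- int n - 1))" .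
  have "z ^ Suc n * cauchy_transform M (\<lambda>w. w powi (- int (Suc n)) * h w) z =
      z ^ n * (z * cauchy_transform M (\<lambda>w. w powi (- int (Suc n)) * h w) z)"
    by (simp only: power_Suc mult_ac)
  then have "z ^ Suc n * cauchy_transform M (\<lambda>w. w powi (- int (Suc n)) * h w) z =
      z ^ n * (cauchy_transform M (\<lambda>w. w powi (- int n) * h w) z -
        (LINT w|M. h w * w powi (- int n - 1)))"
    unfolding st .
  then show ?case
    using Suc.IH by (simp only: sum.lessThan_Suc) (simp only: algebra_simps)
qed simp

lemma eventually_norm_neq_1_at_0: "\<forall>\<^sub>F z::complex in at 0. z \<noteq> 0 \<and> cmod z \<noteq> 1"
  by (auto simp: eventually_at dist_norm intro!: exI[of _ 1])

lemma eventually_norm_neq_1_at_infinity: "\<forall>\<^sub>F z::complex in at_infinity. z \<noteq> 0 \<and> cmod z \<noteq> 1"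
  by (auto simp: eventually_at_infinity intro!: exI[of _ 2])

lemma bigo_eventually_cong:
  assumes "\<forall>\<^sub>F z in F. f z = g z" "g \<in> O[F](h)"
  shows "f \<in> O[F](h)"
  using assms by (simp add: landau_o.big.in_cong)

lemma power_cauchy_transform_bigo_infinity:
  assumes "circle_prob M" "circle_bounded h"
  shows "(\<lambda>z. z ^ a * cauchy_transform M h z) \<in> O[at_infinity](\<lambda>z. z powi (int a - 1))"
proof -
  have "(\<lambda>z. z ^ a * cauchy_transform M h z) \<in> O[at_infinity](\<lambda>z. z ^ a * inverse z)"
    by (rule landau_o.big.mult_left[OF cauchy_transform_bigo_infinity[OF assms]])
  moreover have "\<forall>\<^sub>F z::complex in at_infinity. z ^ a * inverse z = z powi (int a - 1)"
    using eventually_norm_neq_1_at_infinity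
    by eventually_elim (simp add: power_int_diff field_simps)
  ultimately show ?thesis by (subst (asm) landau_o.big.cong) auto
qed

lemma power_cauchy_transform_bigo_0:
  assumes "circle_prob M" "circle_bounded h"
  shows "(\<lambda>z. z ^ a * cauchy_transform M h z) \<in> O[at 0](\<lambda>z. z ^ a)"
  using landau_o.big.mult_left[OF cauchy_transform_bigo_0[OF assms], of "\<lambda>z. z ^ a"]
  by (simp only: mult_1_right)

section \<open>Vanishing moments and orders of approximation\<close>

text \<open>With the numerator of \<open>cauchy_transform_numerator\<close> the error is exactly
  \<open>z ^ a\<close> times a Cauchy transform. The order at infinity is then automatic, and
  vanishing moments are vanishing Taylor coefficients, which add the factor \<open>z ^ n\<close> at
  0.\<close>

lemma moments_imp_cauchy_approximation:
  assumes M: "circle_prob M" and g: "circle_bounded g" and P: "degree P \<le> N" and a: "a \<le> N"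
    and mom: "\<And>l. l < n \<Longrightarrow>
      (LINT w|M. w powi (- int a) * (poly P w * g w) * w powi (- int l - 1)) = 0"
  shows "\<exists>R. (\<forall>i\<ge>N. coeff R i = 0) \<and>
    (\<lambda>z. poly P z * cauchy_transform M g z + poly R z) \<in> O[at 0](\<lambda>z. z ^ (a + n)) \<and>
    (\<lambda>z. poly P z * cauchy_transform M g z + poly R z) \<in> O[at_infinity](\<lambda>z. z powi (int a - 1))"
proof -
  define h where "h w = w powi (- int a) * (poly P w * g w)" for w
  have h: "circle_bounded h" unfolding h_def
    by (intro circle_bounded_mult circle_bounded_power_int circle_bounded_poly g)
  have h': "circle_bounded (\<lambda>w. w powi (- int n) * h w)"
    by (intro circle_bounded_mult circle_bounded_power_int h)
  obtain R where R: "\<forall>i\<ge>N. coeff R i = 0" "\<And>z. cmod z \<noteq> 1 \<Longrightarrow>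
      poly P z * cauchy_transform M g z + poly R z = z ^ a * cauchy_transform M h z"
    using cauchy_transform_numerator[OF M g P a] unfolding h_def by blast
  have ex: "cauchy_transform M h z = z ^ n * cauchy_transform M (\<lambda>w. w powi (- int n) * h w) z"
    if "cmod z \<noteq> 1" for z
    using cauchy_transform_expand[OF M h that, of n] mom by (simp add: h_def)
  have "\<forall>\<^sub>F z in at 0. poly P z * cauchy_transform M g z + poly R z =
      z ^ (a + n) * cauchy_transform M (\<lambda>w. w powi (- int n) * h w) z"
    using eventually_norm_neq_1_at_0
    by eventually_elim (simp add: R(2) ex power_add mult.assoc)
  then have "(\<lambda>z. poly P z * cauchy_transform M g z + poly R z) \<in> O[at 0](\<lambda>z. z ^ (a + n))"
    by (rule bigo_eventually_cong[OF _ power_cauchy_transform_bigo_0[OF M h', of "a + n"]])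
  moreover have "\<forall>\<^sub>F z in at_infinity. poly P z * cauchy_transform M g z + poly R z =
      z ^ a * cauchy_transform M h z"
    using eventually_norm_neq_1_at_infinity by eventually_elim (simp add: R(2))
  then have "(\<lambda>z. poly P z * cauchy_transform M g z + poly R z)
      \<in> O[at_infinity](\<lambda>z. z powi (int a - 1))"
    by (rule bigo_eventually_cong[OF _ power_cauchy_transform_bigo_infinity[OF M h, of a]])
  ultimately show ?thesis using R(1) by blast
qed

text \<open>A given \<open>R\<close> differs from the numerator \<open>R0\<close> by a polynomial
  \<open>E\<close>. The order at 0 removes its coefficients below \<open>a\<close>, the order at
  infinity those from \<open>a\<close> on, so \<open>E = 0\<close> and the error is again
  \<open>z ^ a\<close> times a Cauchy transform.\<close>

lemma cauchy_approximation_imp_moments: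
  assumes M: "circle_prob M" and g: "circle_bounded g" and P: "degree P \<le> N" and a: "a \<le> N"
    and O0: "(\<lambda>z. poly P z * cauchy_transform M g z + poly R z) \<in> O[at 0](\<lambda>z. z ^ (a + n))"
    and Oinf: "(\<lambda>z. poly P z * cauchy_transform M g z + poly R z)
      \<in> O[at_infinity](\<lambda>z. z powi (int a - 1))"
    and l: "l < n"
  shows "(LINT w|M. w powi (- int a) * (poly P w * g w) * w powi (- int l - 1)) = 0"
proof -
  let ?f = "\<lambda>z. poly P z * cauchy_transform M g z + poly R z"
  define h where "h w = w powi (- int a) * (poly P w * g w)" for w
  have h: "circle_bounded h" unfolding h_def
    by (intro circle_bounded_mult circle_bounded_power_int circle_bounded_poly g)
  have h': "circle_bounded (\<lambda>w. w powi (- int n) * h w)"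
    by (intro circle_bounded_mult circle_bounded_power_int h)
  obtain R0 where R0: "\<And>z. cmod z \<noteq> 1 \<Longrightarrow>
      poly P z * cauchy_transform M g z + poly R0 z = z ^ a * cauchy_transform M h z"
    using cauchy_transform_numerator[OF M g P a] unfolding h_def by blast
  define E where "E = R - R0"
  have E: "poly E z = ?f z - z ^ a * cauchy_transform M h z" if "cmod z \<noteq> 1" for z
    using R0[OF that, symmetric] by (simp add: E_def)
  have zn: "(\<lambda>z::complex. z ^ (a + n)) \<in> O[at 0](\<lambda>z. z ^ a)"
  proof (rule bigoI[of _ 1])
    have "cmod (z ^ (a + n)) \<le> 1 * cmod (z ^ a)" if "cmod z \<le> 1" for z :: complex
      using that by (simp add: norm_mult norm_power power_add mult_left_le power_le_one)
    then show "\<forall>\<^sub>F z::complex in at 0. cmod (z ^ (a + n)) \<le> 1 * cmod (z ^ a)"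
      by (auto simp: eventually_at dist_norm intro!: exI[of _ 1])
  qed
  have "(\<lambda>z. ?f z - z ^ a * cauchy_transform M h z) \<in> O[at 0](\<lambda>z. z ^ a)"
    by (rule sum_in_bigo(2)[OF landau_o.big_trans[OF O0 zn] power_cauchy_transform_bigo_0[OF M h]])
  moreover have "\<forall>\<^sub>F z in at 0. poly E z = ?f z - z ^ a * cauchy_transform M h z"
    using eventually_norm_neq_1_at_0 by eventually_elim (use E in blast)
  ultimately have "poly E \<in> O[at 0](\<lambda>z. z ^ a)"
    by (rule bigo_eventually_cong[rotated])
  then have low: "coeff E k = 0" if "k < a" for k using poly_bigo_at_0 that by blast
  have "(\<lambda>z. ?f z - z ^ a * cauchy_transform M h z) \<in> O[at_infinity](\<lambda>z. z powi (int a - 1))"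
    by (rule sum_in_bigo(2)[OF Oinf power_cauchy_transform_bigo_infinity[OF M h]])
  moreover have "\<forall>\<^sub>F z in at_infinity. poly E z = ?f z - z ^ a * cauchy_transform M h z"
    using eventually_norm_neq_1_at_infinity by eventually_elim (use E in blast)
  ultimately have "poly E \<in> O[at_infinity](\<lambda>z. z powi (int a - 1))"
    by (rule bigo_eventually_cong[rotated])
  then have "coeff E k = 0" if "k \<ge> a" for k using poly_bigo_at_infinity that by blast
  with low have "E = 0" by (metis coeff_0 linorder_not_le poly_eqI)
  have "\<forall>\<^sub>F z in at 0. z ^ a * cauchy_transform M h z = ?f z"
    using eventually_norm_neq_1_at_0
  proof eventually_elim
    case (elim z)
    then show ?case using E[of z] \<open>E = 0\<close> by simp
  qed
  then have "(\<lambda>z. z ^ a * cauchy_transform M h z) \<in> O[at 0](\<lambda>z. z ^ (a + n))"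
    by (rule bigo_eventually_cong[OF _ O0])
  then have "(\<lambda>z. z ^ a * cauchy_transform M h z) \<in> O[at 0](\<lambda>z. z ^ a * z ^ n)"
    by (simp only: power_add)
  then have Ch: "cauchy_transform M h \<in> O[at 0](\<lambda>z. z ^ n)"
    by (rule landau_o.big.mult_cancel_left[THEN iffD1, rotated 2])
       (simp, rule eventually_mono[OF eventually_norm_neq_1_at_0], simp)
  define m where "m l = (LINT w|M. h w * w powi (- int l - 1))" for l
  define Q where "Q = (\<Sum>l<n. monom (m l) l)"
  \<comment> \<open>Subtracting the remainder leaves the Taylor polynomial \<open>Q\<close> of
    degree below \<open>n\<close>; being O(\<open>z ^ n\<close>), it is zero.\<close>
  have "(\<lambda>z. cauchy_transform M h z - z ^ n * cauchy_transform M (\<lambda>w. w powi (- int n) * h w) z)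
      \<in> O[at 0](\<lambda>z. z ^ n)"
    by (rule sum_in_bigo(2)[OF Ch power_cauchy_transform_bigo_0[OF M h']])
  moreover have "\<forall>\<^sub>F z in at 0. poly Q z =
      cauchy_transform M h z - z ^ n * cauchy_transform M (\<lambda>w. w powi (- int n) * h w) z"
    using eventually_norm_neq_1_at_0
  proof eventually_elim
    case (elim z)
    have "poly Q z = (\<Sum>l<n. m l * z ^ l)" by (simp add: Q_def poly_sum poly_monom)
    then show ?case using cauchy_transform_expand[OF M h, of z n] elim by (simp add: m_def)
  qed
  ultimately have "poly Q \<in> O[at 0](\<lambda>z. z ^ n)"
    by (rule bigo_eventually_cong[rotated])
  then have "coeff Q l = 0" using l by (rule poly_bigo_at_0)
  moreover have "coeff Q l = m l" using l by (simp add: Q_def coeff_sum)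
  ultimately show ?thesis by (simp add: m_def h_def)
qed

lemma half_pow_bigo_0_iff:
  assumes "\<And>z. z \<noteq> 0 \<Longrightarrow> cmod z \<noteq> 1 \<Longrightarrow> f z = half_pow t0 m z * D z" "k = m + 2 * int b"
  shows "f \<in> O[at 0](half_pow t0 k) \<longleftrightarrow> D \<in> O[at 0](\<lambda>z. z ^ b)"
proof -
  have st: "O[at 0](half_pow t0 k) = O[at 0](\<lambda>z. half_pow t0 m z * z ^ b)"
    by (rule landau_o.big.cong, rule eventually_mono[OF eventually_norm_neq_1_at_0])
       (simp add: assms(2) half_pow_add half_pow_double_nat)
  have "\<forall>\<^sub>F z in at 0. f z = half_pow t0 m z * D z"
    using eventually_norm_neq_1_at_0 by eventually_elim (use assms in blast)
  then have "f \<in> O[at 0](half_pow t0 k) \<longleftrightarrow> (\<lambda>z. half_pow t0 m z * D z) \<in> O[at 0](half_pow t0 k)"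
    by (rule landau_o.big.in_cong)
  also have "\<dots> \<longleftrightarrow> (\<lambda>z. half_pow t0 m z * D z) \<in> O[at 0](\<lambda>z. half_pow t0 m z * z ^ b)"
    by (simp only: st)
  also have "(\<lambda>z. half_pow t0 m z * D z) \<in> O[at 0](\<lambda>z. half_pow t0 m z * z ^ b) \<longleftrightarrow> D \<in> O[at 0](\<lambda>z. z ^ b)"
    by (rule landau_o.big.mult_cancel_left)
       (simp, rule eventually_mono[OF eventually_norm_neq_1_at_0], simp)
  finally show ?thesis .
qed

lemma half_pow_bigo_infinity_iff:
  assumes "\<And>z. z \<noteq> 0 \<Longrightarrow> cmod z \<noteq> 1 \<Longrightarrow> f z = half_pow t0 m z * D z" "k = m + 2 * b"
  shows "f \<in> O[at_infinity](half_pow t0 k) \<longleftrightarrow> D \<in> O[at_infinity](\<lambda>z. z powi b)"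
proof -
  have st: "O[at_infinity](half_pow t0 k) = O[at_infinity](\<lambda>z. half_pow t0 m z * z powi b)"
    by (rule landau_o.big.cong, rule eventually_mono[OF eventually_norm_neq_1_at_infinity])
       (simp add: assms(2) half_pow_add half_pow_double)
  have "\<forall>\<^sub>F z in at_infinity. f z = half_pow t0 m z * D z"
    using eventually_norm_neq_1_at_infinity by eventually_elim (use assms in blast)
  then have "f \<in> O[at_infinity](half_pow t0 k) \<longleftrightarrow>
      (\<lambda>z. half_pow t0 m z * D z) \<in> O[at_infinity](half_pow t0 k)"
    by (rule landau_o.big.in_cong)
  also have "\<dots> \<longleftrightarrow> (\<lambda>z. half_pow t0 m z * D z) \<in> O[at_infinity](\<lambda>z. half_pow t0 m z * z powi b)"
    by (simp only: st)
  also have "(\<lambda>z. half_pow t0 m z * D z) \<in> O[at_infinity](\<lambda>z. half_pow t0 m z * z powi b) \<longleftrightarrow> D \<in> O[at_infinity](\<lambda>z. z powi b)"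
    by (rule landau_o.big.mult_cancel_left)
       (simp, rule eventually_mono[OF eventually_norm_neq_1_at_infinity], simp)
  finally show ?thesis .
qed

text \<open>The case \<open>e = 0\<close>, \<open>\<kappa> = -1\<close>, \<open>\<gamma> = 2\<close> is the one of \<open>F\<close>, since \<open>(w + z) / (w - z) = -1 + 2 w / (w - z)\<close>;
  the case \<open>e = 1\<close>, \<open>\<kappa> = 0\<close>, \<open>\<gamma> = 1\<close> is the one of \<open>G\<close>.\<close>

lemma approximation_iff_orthogonal:
  fixes t0 :: real
  defines "g \<equiv> \<lambda>\<gamma> e w. \<gamma> * half_pow t0 (2 - int e) w"
  assumes M: "circle_prob M" and N: "N = p + 2 * a + e" and e: "\<kappa> = 0 \<or> e = 0" "e \<le> 1"
    and \<gamma>: "\<gamma> \<noteq> 0" and P: "degree P \<le> N"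
    and \<phi>: "\<And>z. z \<noteq> 0 \<Longrightarrow> \<phi> z = half_pow t0 (- int N) z * poly P z"
    and T: "\<And>z. z \<noteq> 0 \<Longrightarrow> cmod z \<noteq> 1 \<Longrightarrow>
      T z = half_pow t0 (int e) z * (cauchy_transform M (g \<gamma> e) z + \<kappa>)"
  shows "(\<exists>\<psi>. \<psi> \<in> half_span t0 (int e - int N) (int N - int e) \<and>
      (\<lambda>z. \<phi> z * T z + \<psi> z) \<in> O[at 0](half_pow t0 (int p)) \<and>
      (\<lambda>z. \<phi> z * T z + \<psi> z) \<in> O[at_infinity](half_pow t0 (- int p - 2))) \<longleftrightarrow>
    (\<forall>l<p. (LINT w|M. poly P w * w ^ l * half_pow t0 (2 - int N - int p) w) = 0)"
proof -
  let ?C = "cauchy_transform M (g \<gamma> e)"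
  have g: "circle_bounded (g \<gamma> e)" unfolding g_def
    by (intro circle_bounded_mult circle_bounded_const circle_bounded_half_pow)
  have span: "\<psi> \<in> half_span t0 (int e - int N) (int N - int e) \<longleftrightarrow>
     (\<exists>Q. degree Q \<le> N - e \<and> (\<forall>z. z \<noteq> 0 \<longrightarrow> \<psi> z = half_pow t0 (int e - int N) z * poly Q z))" for \<psi>
    using half_span_iff_poly[of \<psi> t0 "int e - int N" "N - e"] N by (simp add: algebra_simps)
  have prod: "\<phi> z * T z + \<psi> z =
      half_pow t0 (int e - int N) z * (poly P z * ?C z + poly (Polynomial.smult \<kappa> P + Q) z)"
    if "z \<noteq> 0" "cmod z \<noteq> 1" "\<psi> z = half_pow t0 (int e - int N) z * poly Q z" for \<psi> Q z
  proof -
    have "half_pow t0 (int e - int N) z = half_pow t0 (- int N) z * half_pow t0 (int e) z"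
      using half_pow_add[OF that(1), of t0 "- int N" "int e"] by (simp add: algebra_simps)
    then show ?thesis using \<phi>[OF that(1)] T[OF that(1,2)] that(3) by (simp add: algebra_simps)
  qed
  \<comment> \<open>Here \<open>N = p + 2 * a + e\<close> enters: after removal of the common factor
    \<open>z^((e - N)/2)\<close> the two required half-integer orders become the integer orders
    \<open>a + p\<close> at 0 and \<open>a - 1\<close> at infinity.\<close>
  have exps: "int p = (int e - int N) + 2 * int (a + p)"
    "- int p - 2 = (int e - int N) + 2 * (int a - 1)" using N by simp_all
  \<comment> \<open>The moments come with decreasing powers of \<open>w\<close>; reading them
    backwards, \<open>l\<close> as \<open>p - 1 - l\<close>, leaves nonnegative powers times one
    fixed half-integer power.\<close>
  have mom: "(LINT w|M. w powi (- int a) * (poly P w * g \<gamma> e w) * w powi (- int l - 1)) =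
      \<gamma> * (LINT w|M. poly P w * w ^ (p - 1 - l) * half_pow t0 (2 - int N - int p) w)" if l: "l < p" for l
  proof -
    have "(LINT w|M. w powi (- int a) * (poly P w * g \<gamma> e w) * w powi (- int l - 1)) =
        (LINT w|M. \<gamma> * (poly P w * w ^ (p - 1 - l) * half_pow t0 (2 - int N - int p) w))"
    proof (intro Bochner_Integration.integral_cong refl)
      fix w assume "w \<in> space M"
      then have w: "w \<noteq> 0" by (auto simp: circle_prob_space[OF M])
      have "w powi (- int a) * half_pow t0 (2 - int e) w * w powi (- int l - 1) =
          half_pow t0 (2 * (- int a) + (2 - int e) + 2 * (- int l - 1)) w"
        by (simp only: half_pow_add[OF w] half_pow_double)
      also have "2 * (- int a) + (2 - int e) + 2 * (- int l - 1) =
          2 * int (p - 1 - l) + (2 - int N - int p)" using N l by simp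
      also have "half_pow t0 \<dots> w = w ^ (p - 1 - l) * half_pow t0 (2 - int N - int p) w"
        by (simp only: half_pow_add[OF w] half_pow_double_nat)
      finally have *: "w powi (- int a) * half_pow t0 (2 - int e) w * w powi (- int l - 1) =
        w ^ (p - 1 - l) * half_pow t0 (2 - int N - int p) w" .
      have "w powi (- int a) * (poly P w * g \<gamma> e w) * w powi (- int l - 1) =
          \<gamma> * poly P w * (w powi (- int a) * half_pow t0 (2 - int e) w * w powi (- int l - 1))"
        by (simp only: g_def mult_ac)
      then show "w powi (- int a) * (poly P w * g \<gamma> e w) * w powi (- int l - 1) =
          \<gamma> * (poly P w * w ^ (p - 1 - l) * half_pow t0 (2 - int N - int p) w)"
        unfolding * by (simp only: mult_ac)
    qed
    then show ?thesis by (simp only: integral_mult_right_zero)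
  qed
  show ?thesis
  proof
    assume "\<exists>\<psi>. \<psi> \<in> half_span t0 (int e - int N) (int N - int e) \<and>
      (\<lambda>z. \<phi> z * T z + \<psi> z) \<in> O[at 0](half_pow t0 (int p)) \<and>
      (\<lambda>z. \<phi> z * T z + \<psi> z) \<in> O[at_infinity](half_pow t0 (- int p - 2))"
    then obtain \<psi> Q where Q: "\<And>z. z \<noteq> 0 \<Longrightarrow> \<psi> z = half_pow t0 (int e - int N) z * poly Q z"
      and O: "(\<lambda>z. \<phi> z * T z + \<psi> z) \<in> O[at 0](half_pow t0 (int p))"
        "(\<lambda>z. \<phi> z * T z + \<psi> z) \<in> O[at_infinity](half_pow t0 (- int p - 2))"
      unfolding span by blast
    have pr: "\<phi> z * T z + \<psi> z = half_pow t0 (int e - int N) z *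
        (poly P z * ?C z + poly (Polynomial.smult \<kappa> P + Q) z)" if "z \<noteq> 0" "cmod z \<noteq> 1" for z
      by (rule prod[where \<psi> = \<psi>, OF that Q[OF that(1)]])
    have O': "(\<lambda>z. poly P z * ?C z + poly (Polynomial.smult \<kappa> P + Q) z) \<in> O[at 0](\<lambda>z. z ^ (a + p))"
      "(\<lambda>z. poly P z * ?C z + poly (Polynomial.smult \<kappa> P + Q) z) \<in> O[at_infinity](\<lambda>z. z powi (int a - 1))"
      using O half_pow_bigo_0_iff[OF pr exps(1)] half_pow_bigo_infinity_iff[OF pr exps(2)] by blast+
    show "\<forall>l<p. (LINT w|M. poly P w * w ^ l * half_pow t0 (2 - int N - int p) w) = 0"
    proof (intro allI impI)
      fix l assume l: "l < p"
      then have "p - 1 - l < p" "p - 1 - (p - 1 - l) = l" by auto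
      then show "(LINT w|M. poly P w * w ^ l * half_pow t0 (2 - int N - int p) w) = 0"
        using cauchy_approximation_imp_moments[OF M g P _ O', of "p - 1 - l"] mom[of "p - 1 - l"] N \<gamma>
        by simp
    qed
  next
    assume orth: "\<forall>l<p. (LINT w|M. poly P w * w ^ l * half_pow t0 (2 - int N - int p) w) = 0"
    have "(LINT w|M. w powi (- int a) * (poly P w * g \<gamma> e w) * w powi (- int l - 1)) = 0" if "l < p" for l
      using mom[OF that] orth that by simp
    then obtain R where R: "\<forall>i\<ge>N. coeff R i = 0"
      "(\<lambda>z. poly P z * ?C z + poly R z) \<in> O[at 0](\<lambda>z. z ^ (a + p))"
      "(\<lambda>z. poly P z * ?C z + poly R z) \<in> O[at_infinity](\<lambda>z. z powi (int a - 1))"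
      using moments_imp_cauchy_approximation[OF M g P, of a p] N by auto
    define Q where "Q = R - Polynomial.smult \<kappa> P"
    define \<psi> where "\<psi> z = half_pow t0 (int e - int N) z * poly Q z" for z
    \<comment> \<open>For \<open>e = 0\<close> the multiple of \<open>P\<close> in \<open>Q\<close>
      may have degree \<open>N\<close>, which is allowed. For \<open>e = 1\<close> the degree must
      stay below \<open>N\<close>; there \<open>\<kappa> = 0\<close>, so \<open>Q = R\<close> has no
      coefficients from index \<open>N\<close> on.\<close>
    have "coeff Q i = 0" if "i > N - e" for i
    proof (cases "e = 0")
      case True
      then show ?thesis using R(1) that P by (simp add: Q_def coeff_eq_0)
    next
      case False
      then show ?thesis using R(1) that e by (simp add: Q_def)
    qed
    then have "degree Q \<le> N - e" by (intro degree_le) blast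
    then have "\<psi> \<in> half_span t0 (int e - int N) (int N - int e)"
      unfolding span \<psi>_def by blast
    moreover have RQ: "Polynomial.smult \<kappa> P + Q = R" by (simp add: Q_def)
    have pr: "\<phi> z * T z + \<psi> z = half_pow t0 (int e - int N) z * (poly P z * ?C z + poly R z)"
      if "z \<noteq> 0" "cmod z \<noteq> 1" for z
      using prod[where \<psi> = \<psi>, OF that \<psi>_def] unfolding RQ .
    have "(\<lambda>z. \<phi> z * T z + \<psi> z) \<in> O[at 0](half_pow t0 (int p))"
      "(\<lambda>z. \<phi> z * T z + \<psi> z) \<in> O[at_infinity](half_pow t0 (- int p - 2))"
      using R(2,3) half_pow_bigo_0_iff[OF pr exps(1)] half_pow_bigo_infinity_iff[OF pr exps(2)] by blast+
    ultimately show "\<exists>\<psi>. \<psi> \<in> half_span t0 (int e - int N) (int N - int e) \<and>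
      (\<lambda>z. \<phi> z * T z + \<psi> z) \<in> O[at 0](half_pow t0 (int p)) \<and>
      (\<lambda>z. \<phi> z * T z + \<psi> z) \<in> O[at_infinity](half_pow t0 (- int p - 2))" by blast
  qed
qed

section \<open>From the approximation problem to multiple orthogonality\<close>

lemma F_transform_eq_cauchy:
  assumes M: "circle_prob M" and z: "cmod z \<noteq> 1"
  shows "F_transform M z = cauchy_transform M (\<lambda>w. 2 * half_pow t0 2 w) z - 1"
proof -
  interpret prob_space M using M by (simp add: circle_prob_def)
  have b: "circle_bounded (\<lambda>w. 2 * half_pow t0 2 w)"
    by (intro circle_bounded_mult circle_bounded_const circle_bounded_half_pow)
  have "F_transform M z = (LINT w|M. 2 * half_pow t0 2 w / (w - z) - 1)"
    unfolding F_transform_def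
  proof (intro Bochner_Integration.integral_cong refl)
    fix w assume "w \<in> space M"
    then have "w - z \<noteq> 0" using z by (auto simp: circle_prob_space[OF M])
    moreover have "half_pow t0 2 w = w" using half_pow_double[of t0 1 w] by simp
    ultimately show "(w + z) / (w - z) = 2 * half_pow t0 2 w / (w - z) - 1"
      by (simp add: divide_simps)
  qed
  also have "\<dots> = cauchy_transform M (\<lambda>w. 2 * half_pow t0 2 w) z - (LINT w|M. 1)"
    unfolding cauchy_transform_def
    by (intro Bochner_Integration.integral_diff circle_bounded_integrable[OF M]
        circle_bounded_cauchy_kernel circle_bounded_const b z)
  finally show ?thesis by (simp add: prob_space)
qed

lemma G_transform_eq_cauchy:
  "G_transform t0 M z = half_pow t0 1 z * cauchy_transform M (\<lambda>w. 1 * half_pow t0 1 w) z"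
proof -
  have "G_transform t0 M z = (LINT w|M. half_pow t0 1 z * (1 * half_pow t0 1 w / (w - z)))"
    unfolding G_transform_def
    by (intro Bochner_Integration.integral_cong) (simp_all add: half_pow_def)
  then show ?thesis unfolding cauchy_transform_def by (simp only: integral_mult_right_zero)
qed

definition multiple_orthogonal ::
  "real \<Rightarrow> nat \<Rightarrow> (nat \<Rightarrow> nat) \<Rightarrow> (nat \<Rightarrow> complex measure) \<Rightarrow> complex poly \<Rightarrow> bool" where
  "multiple_orthogonal t0 r n \<mu> P \<longleftrightarrow> (\<forall>j\<in>{1..r}. \<forall>l<n j.
     (LINT w|\<mu> j. poly P w * w ^ l * half_pow t0 (2 - int (index_size r n) - int (n j)) w) = 0)"

lemma approx_solution_iff_orthogonal:
  fixes n :: "nat \<Rightarrow> nat" and r :: nat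
  assumes \<mu>: "\<forall>j\<in>{1..r}. circle_prob (\<mu> j)"
  defines "N \<equiv> index_size r n"
  shows "(\<exists>\<psi>. approx_solution t0 r n \<mu> \<phi> \<psi>) \<longleftrightarrow>
    (\<exists>P. degree P \<le> N \<and> (\<forall>z. z \<noteq> 0 \<longrightarrow> \<phi> z = half_pow t0 (- int N) z * poly P z) \<and>
      multiple_orthogonal t0 r n \<mu> P)"
proof -
  define cond where "cond j \<psi> \<longleftrightarrow>
        (even (int N - int (n j)) \<longrightarrow>
           \<psi> \<in> half_span t0 (- int N) (int N) \<and>
           (\<lambda>z. \<phi> z * F_transform (\<mu> j) z + \<psi> z) \<in> O[at 0](half_pow t0 (int (n j))) \<and>
           (\<lambda>z. \<phi> z * F_transform (\<mu> j) z + \<psi> z)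
             \<in> O[at_infinity](half_pow t0 (- int (n j) - 2))) \<and>
        (odd (int N - int (n j)) \<longrightarrow>
           \<psi> \<in> half_span t0 (- int N + 1) (int N - 1) \<and>
           (\<lambda>z. \<phi> z * G_transform t0 (\<mu> j) z + \<psi> z) \<in> O[at 0](half_pow t0 (int (n j))) \<and>
           (\<lambda>z. \<phi> z * G_transform t0 (\<mu> j) z + \<psi> z)
             \<in> O[at_infinity](half_pow t0 (- int (n j) - 2)))" for j and \<psi> :: "complex \<Rightarrow> complex"
  have span: "\<phi> \<in> half_span t0 (- int N) (int N) \<longleftrightarrow>
     (\<exists>P. degree P \<le> N \<and> (\<forall>z. z \<noteq> 0 \<longrightarrow> \<phi> z = half_pow t0 (- int N) z * poly P z))"
    using half_span_iff_poly[of \<phi> t0 "- int N" N] by simp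
  have "(\<exists>\<psi>. approx_solution t0 r n \<mu> \<phi> \<psi>) \<longleftrightarrow>
      \<phi> \<in> half_span t0 (- int N) (int N) \<and> (\<exists>\<psi>. \<forall>j\<in>{1..r}. cond j (\<psi> j))"
    unfolding approx_solution_def Let_def cond_def N_def by blast
  \<comment> \<open>The \<open>\<psi> j\<close> are coupled only through \<open>\<phi>\<close>, so
    they can be chosen separately.\<close>
  also have "(\<exists>\<psi>. \<forall>j\<in>{1..r}. cond j (\<psi> j)) \<longleftrightarrow> (\<forall>j\<in>{1..r}. \<exists>\<psi>. cond j \<psi>)"
    by (rule bchoice_iff[symmetric])
  finally have 1: "(\<exists>\<psi>. approx_solution t0 r n \<mu> \<phi> \<psi>) \<longleftrightarrow>
      \<phi> \<in> half_span t0 (- int N) (int N) \<and> (\<forall>j\<in>{1..r}. \<exists>\<psi>. cond j \<psi>)" .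
  have 2: "(\<exists>\<psi>. cond j \<psi>) \<longleftrightarrow>
      (\<forall>l<n j. (LINT w|\<mu> j. poly P w * w ^ l * half_pow t0 (2 - int N - int (n j)) w) = 0)"
    if j: "j \<in> {1..r}" and P: "degree P \<le> N" "\<And>z. z \<noteq> 0 \<Longrightarrow> \<phi> z = half_pow t0 (- int N) z * poly P z"
    for j P
  proof -
    have M: "circle_prob (\<mu> j)" using \<mu> j by blast
    have le: "n j \<le> N" unfolding N_def index_size_def using j by (intro member_le_sum) auto
    \<comment> \<open>The remainder of \<open>N - n j\<close> modulo 2 is the \<open>e\<close> of
      \<open>approximation_iff_orthogonal\<close>: 0 selects \<open>F\<close>, 1 selects
      \<open>G\<close>.\<close>
    define a where "a = (N - n j) div 2"
    show ?thesis
    proof (cases "even (int N - int (n j))")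
      case True
      then have ev: "even (N - n j)" using le by (simp flip: of_nat_diff)
      have N2: "N = n j + 2 * a + 0" using ev le by (simp add: a_def)
      have T: "F_transform (\<mu> j) z = half_pow t0 (int 0) z *
          (cauchy_transform (\<mu> j) (\<lambda>w. 2 * half_pow t0 (2 - int 0) w) z + (-1))"
        if "cmod z \<noteq> 1" for z
        using F_transform_eq_cauchy[OF M that] by (simp add: half_pow_def)
      show ?thesis
        using approximation_iff_orthogonal[OF M N2 _ _ _ P(1) P(2), of "-1" 2 "F_transform (\<mu> j)", OF _ _ _ _ T]
          True by (simp add: cond_def)
    next
      case False
      then have ev: "odd (N - n j)" using le by (simp flip: of_nat_diff)
      have N2: "N = n j + 2 * a + 1" using ev le unfolding a_def by presburger
      have T: "G_transform t0 (\<mu> j) z = half_pow t0 (int 1) z *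
          (cauchy_transform (\<mu> j) (\<lambda>w. 1 * half_pow t0 (2 - int 1) w) z + 0)" for z
        using G_transform_eq_cauchy[of t0 "\<mu> j" z] by simp
      have eqs: "int 1 - int N = - int N + 1" "int N - int 1 = int N - 1" by simp_all
      show ?thesis
        using approximation_iff_orthogonal[OF M N2 _ _ _ P(1) P(2), of 0 1 "G_transform t0 (\<mu> j)", OF _ _ _ _ T]
          False unfolding eqs by (simp add: cond_def)
    qed
  qed
  have 3: "(\<forall>j\<in>{1..r}. \<exists>\<psi>. cond j \<psi>) \<longleftrightarrow> multiple_orthogonal t0 r n \<mu> P"
    if "degree P \<le> N" "\<forall>z. z \<noteq> 0 \<longrightarrow> \<phi> z = half_pow t0 (- int N) z * poly P z" for P
    unfolding multiple_orthogonal_def N_def[symmetric] using 2[OF _ that(1)] that(2)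
    by (intro ball_cong refl) blast
  show ?thesis unfolding 1 span
    using 3 by meson
qed

section \<open>Trigonometric polynomials\<close>

text \<open>The trigonometric polynomials with frequencies \<open>-(p-1)/2, \<dots>, (p-1)/2\<close>.\<close>

definition trig_space :: "nat \<Rightarrow> (real \<Rightarrow> real) set" where
  "trig_space p = {T. \<exists>q. degree q < p \<and>
     (\<forall>\<theta>. complex_of_real (T \<theta>) = cis (- ((real p - 1) / 2 * \<theta>)) * poly q (cis \<theta>))}"

lemma trig_space_continuous:
  assumes "T \<in> trig_space p"
  shows "continuous_on A T"
proof -
  obtain q where q: "\<And>\<theta>. complex_of_real (T \<theta>) = cis (- ((real p - 1) / 2 * \<theta>)) * poly q (cis \<theta>)"
    using assms unfolding trig_space_def by blast
  have T: "T = (\<lambda>\<theta>. Re (cis (- ((real p - 1) / 2 * \<theta>)) * poly q (cis \<theta>)))"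
    by (rule ext) (simp only: q[symmetric] Re_complex_of_real)
  show ?thesis unfolding T by (intro continuous_intros)
qed

lemma arg_from_cis:
  assumes "t0 \<le> \<theta>" "\<theta> < t0 + 2 * pi"
  shows "arg_from t0 (cis \<theta>) = \<theta>"
proof -
  have "cis \<theta> * cis (- t0) = cis (\<theta> - t0)" by (simp add: cis_mult)
  also have "\<dots> = exp (\<i> * of_real (\<theta> - t0))" by (rule cis_conv_exp)
  finally have "cis \<theta> * cis (- t0) = exp (\<i> * of_real (\<theta> - t0))" .
  then show ?thesis
    using Arg2pi_exp[of "\<i> * of_real (\<theta> - t0)"] assms by (simp add: arg_from_def)
qed

lemma cis_arg_from:
  assumes "cmod w = 1"
  shows "cis (arg_from t0 w) = w"
  using arg_from_eq[of w t0] assms by simp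

lemma inj_on_cis: "inj_on cis {t0..<t0 + 2 * pi}"
  by (rule inj_on_inverseI[of _ "arg_from t0"]) (simp add: arg_from_cis)

text \<open>On a half-open period \<open>cis\<close> is injective and sends zeros of
  \<open>T\<close> to roots of \<open>q\<close>, whose degree is below \<open>p\<close>.\<close>

lemma trig_space_zeros:
  assumes T: "T \<in> trig_space p" and nz: "T y \<noteq> 0"
  shows "finite {x \<in> {t0..<t0 + 2 * pi}. T x = 0}" "card {x \<in> {t0..<t0 + 2 * pi}. T x = 0} < p"
proof -
  let ?Z = "{x \<in> {t0..<t0 + 2 * pi}. T x = 0}"
  obtain q where q: "degree q < p"
    "\<And>\<theta>. complex_of_real (T \<theta>) = cis (- ((real p - 1) / 2 * \<theta>)) * poly q (cis \<theta>)"
    using T unfolding trig_space_def by blast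
  have q0: "q \<noteq> 0" using q(2)[of y] nz by auto
  have sub: "cis ` ?Z \<subseteq> {z. poly q z = 0}"
  proof
    fix z assume "z \<in> cis ` ?Z"
    then obtain x where "T x = 0" "z = cis x" by auto
    then show "z \<in> {z. poly q z = 0}" using q(2)[of x] by simp
  qed
  have inj: "inj_on cis ?Z" by (rule inj_on_subset[OF inj_on_cis]) auto
  have fin: "finite {z. poly q z = 0}" using q0 by (rule poly_roots_finite)
  show "finite ?Z" using finite_imageD[OF finite_subset[OF sub fin] inj] .
  have "card ?Z = card (cis ` ?Z)" using card_image[OF inj] by simp
  also have "\<dots> \<le> card {z. poly q z = 0}" by (rule card_mono[OF fin sub])
  also have "\<dots> \<le> degree q" using q0 by (rule card_poly_roots_bound)
  finally show "card ?Z < p" using q(1) by simp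
qed

lemma trig_space_finite_zeros:
  assumes "T \<in> trig_space p" "T y \<noteq> 0"
  shows "finite {x \<in> {t0..t0 + 2 * pi}. T x = 0}"
proof (rule finite_subset)
  show "{x \<in> {t0..t0 + 2 * pi}. T x = 0} \<subseteq> insert (t0 + 2 * pi) {x \<in> {t0..<t0 + 2 * pi}. T x = 0}"
    by auto
qed (use trig_space_zeros(1)[OF assms] in simp)

lemma trig_space_const: "(\<lambda>_. c) \<in> trig_space 1"
  unfolding trig_space_def by (intro CollectI exI[of _ "[:complex_of_real c:]"]) auto

text \<open>The highest frequency in \<open>trig_space p\<close> is \<open>(p - 1) / 2\<close>, and
  highest frequencies add; the form with \<open>Suc\<close> avoids truncated subtraction.\<close>

lemma trig_space_mult:
  assumes "S \<in> trig_space (Suc a)" "T \<in> trig_space (Suc b)"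
  shows "(\<lambda>\<theta>. S \<theta> * T \<theta>) \<in> trig_space (Suc (a + b))"
proof -
  obtain u v where u: "degree u < Suc a"
      "\<And>\<theta>. complex_of_real (S \<theta>) = cis (- ((real (Suc a) - 1) / 2 * \<theta>)) * poly u (cis \<theta>)"
    and v: "degree v < Suc b"
      "\<And>\<theta>. complex_of_real (T \<theta>) = cis (- ((real (Suc b) - 1) / 2 * \<theta>)) * poly v (cis \<theta>)"
    using assms unfolding trig_space_def by blast
  have "degree (u * v) < Suc (a + b)" using u(1) v(1) degree_mult_le[of u v] by simp
  moreover have "complex_of_real (S \<theta> * T \<theta>) =
      cis (- ((real (Suc (a + b)) - 1) / 2 * \<theta>)) * poly (u * v) (cis \<theta>)" for \<theta>
  proof -
    have "cis (- ((real (Suc (a + b)) - 1) / 2 * \<theta>)) =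
        cis (- ((real (Suc a) - 1) / 2 * \<theta>)) * cis (- ((real (Suc b) - 1) / 2 * \<theta>))"
      unfolding cis_mult by (rule arg_cong[of _ _ cis]) (simp add: field_simps)
    then show ?thesis unfolding of_real_mult u(2) v(2) by (simp only: poly_mult mult_ac)
  qed
  ultimately show ?thesis unfolding trig_space_def by blast
qed

text \<open>The trigonometric counterpart of the linear factor \<open>x - s\<close>: as long as the
  distance from \<open>\<theta>\<close> to \<open>s\<close> is below \<open>2 pi\<close>, it has the
  sign of \<open>\<theta> - s\<close>. The coefficients of \<open>q\<close> come from Euler's
  formula.\<close>

lemma trig_space_sin_diff: "(\<lambda>\<theta>. sin ((\<theta> - s) / 2)) \<in> trig_space 2"
proof -
  define q where "q = [:- cis (s / 2) / (2 * \<i>), cis (- s / 2) / (2 * \<i>):]"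
  have "complex_of_real (sin ((\<theta> - s) / 2)) = cis (- ((real 2 - 1) / 2 * \<theta>)) * poly q (cis \<theta>)" for \<theta>
  proof -
    have "cis (- ((real 2 - 1) / 2 * \<theta>)) * poly q (cis \<theta>) =
        (cis (- (\<theta> / 2)) * cis (- s / 2) * cis \<theta> - cis (- (\<theta> / 2)) * cis (s / 2)) / (2 * \<i>)"
      by (simp add: q_def field_simps)
    also have "cis (- (\<theta> / 2)) * cis (- s / 2) * cis \<theta> = cis ((\<theta> - s) / 2)"
      unfolding cis_mult by (rule arg_cong[of _ _ cis]) (simp add: field_simps)
    also have "cis (- (\<theta> / 2)) * cis (s / 2) = cis (- ((\<theta> - s) / 2))"
      unfolding cis_mult by (rule arg_cong[of _ _ cis]) (simp add: field_simps)
    also have "(cis ((\<theta> - s) / 2) - cis (- ((\<theta> - s) / 2))) / (2 * \<i>) = of_real (sin ((\<theta> - s) / 2))"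
      by (simp add: complex_eq_iff Re_divide Im_divide)
    finally show ?thesis by simp
  qed
  moreover have "degree q < 2" unfolding q_def by (simp add: degree_pCons_eq_if)
  ultimately show ?thesis unfolding trig_space_def by blast
qed

lemma trig_space_prod_sin:
  assumes "finite S"
  shows "(\<lambda>\<theta>. \<Prod>s\<in>S. sin ((\<theta> - s) / 2)) \<in> trig_space (Suc (card S))"
  using assms
proof (induction S rule: finite_induct)
  case empty
  then show ?case using trig_space_const[of 1] by simp
next
  case (insert s S)
  then show ?case
    using trig_space_mult[of "\<lambda>\<theta>. sin ((\<theta> - s) / 2)" 1 "\<lambda>\<theta>. \<Prod>s\<in>S. sin ((\<theta> - s) / 2)" "card S"]
      trig_space_sin_diff[of s] by (simp add: numeral_2_eq_2)
qed

lemma trig_space_power_sin: "(\<lambda>\<theta>. sin ((\<theta> - s) / 2) ^ k) \<in> trig_space (Suc k)"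
proof (induction k)
  case 0
  then show ?case using trig_space_const[of 1] by simp
next
  case (Suc k)
  then show ?case
    using trig_space_mult[of "\<lambda>\<theta>. sin ((\<theta> - s) / 2)" 1 "\<lambda>\<theta>. sin ((\<theta> - s) / 2) ^ k" k]
      trig_space_sin_diff[of s] by (simp add: numeral_2_eq_2)
qed

text \<open>With \<open>i + k = p - 1\<close> the numbers \<open>(i - k) / 2\<close> are precisely
  the frequencies of \<open>trig_space p\<close>. The monomials of degrees \<open>i\<close> and
  \<open>k\<close> lie symmetrically about the centre, and cosine and sine are their
  combinations.\<close>

lemma trig_space_cos_sin:
  assumes p: "p = Suc (i + k)"
  shows "(\<lambda>\<theta>. cos ((real i - real k) / 2 * \<theta>)) \<in> trig_space p"
    and "(\<lambda>\<theta>. sin ((real i - real k) / 2 * \<theta>)) \<in> trig_space p"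
proof -
  have e1: "cis (- ((real p - 1) / 2 * \<theta>)) * cis \<theta> ^ i = cis ((real i - real k) / 2 * \<theta>)" for \<theta>
    unfolding Complex.DeMoivre cis_mult by (rule arg_cong[of _ _ cis]) (simp add: p field_simps)
  have e2: "cis (- ((real p - 1) / 2 * \<theta>)) * cis \<theta> ^ k = cis (- ((real i - real k) / 2 * \<theta>))" for \<theta>
    unfolding Complex.DeMoivre cis_mult by (rule arg_cong[of _ _ cis]) (simp add: p field_simps)
  have deg: "degree (monom a i + monom b k) < p" for a b :: complex
    using degree_add_le[of "monom a i" "i + k" "monom b k"] degree_monom_le[of a i] degree_monom_le[of b k]
    by (simp add: p)
  have "complex_of_real (cos ((real i - real k) / 2 * \<theta>)) =
      cis (- ((real p - 1) / 2 * \<theta>)) * poly (monom (1/2) i + monom (1/2) k) (cis \<theta>)" for \<theta>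
  proof -
    have "cis (- ((real p - 1) / 2 * \<theta>)) * poly (monom (1/2) i + monom (1/2) k) (cis \<theta>) =
        (cis (- ((real p - 1) / 2 * \<theta>)) * cis \<theta> ^ i + cis (- ((real p - 1) / 2 * \<theta>)) * cis \<theta> ^ k) / 2"
      by (simp only: poly_add poly_monom) (simp add: algebra_simps)
    also have "\<dots> = of_real (cos ((real i - real k) / 2 * \<theta>))"
      unfolding e1 e2 by (simp add: complex_eq_iff)
    finally show ?thesis by simp
  qed
  then show "(\<lambda>\<theta>. cos ((real i - real k) / 2 * \<theta>)) \<in> trig_space p"
    using deg unfolding trig_space_def by blast
  have "complex_of_real (sin ((real i - real k) / 2 * \<theta>)) =
      cis (- ((real p - 1) / 2 * \<theta>)) * poly (monom (1/(2*\<i>)) i + monom (-1/(2*\<i>)) k) (cis \<theta>)" for \<theta>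
  proof -
    have "cis (- ((real p - 1) / 2 * \<theta>)) * poly (monom (1/(2*\<i>)) i + monom (-1/(2*\<i>)) k) (cis \<theta>) =
        (cis (- ((real p - 1) / 2 * \<theta>)) * cis \<theta> ^ i - cis (- ((real p - 1) / 2 * \<theta>)) * cis \<theta> ^ k) / (2*\<i>)"
      by (simp only: poly_add poly_monom) (simp add: field_simps)
    also have "\<dots> = of_real (sin ((real i - real k) / 2 * \<theta>))"
      unfolding e1 e2 by (simp add: complex_eq_iff Re_divide Im_divide)
    finally show ?thesis by simp
  qed
  then show "(\<lambda>\<theta>. sin ((real i - real k) / 2 * \<theta>)) \<in> trig_space p"
    using deg unfolding trig_space_def by blast
qed

text \<open>Conjugation on the circle turns \<open>cis \<theta>\<close> into its inverse. Because
  the frequencies are centred, conjugating \<open>X\<close> keeps the central factor and replaces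
  \<open>P\<close> by \<open>Q\<close>, the polynomial with the conjugated coefficients in reverse
  order; real and imaginary parts combine the two.\<close>

lemma trig_space_Re_Im:
  assumes P: "degree P < N"
  defines "X \<equiv> \<lambda>\<theta>. cis (- ((real N - 1) / 2 * \<theta>)) * poly P (cis \<theta>)"
  shows "(\<lambda>\<theta>. Re (X \<theta>)) \<in> trig_space N" "(\<lambda>\<theta>. Im (X \<theta>)) \<in> trig_space N"
proof -
  have N: "N > 0" using P by simp
  define Q where "Q = (\<Sum>i<N. monom (cnj (coeff P (N - 1 - i))) i)"
  have cQ: "coeff Q i = 0" if "i \<ge> N" for i
    using that by (auto simp: Q_def coeff_sum)
  have cP: "coeff P i = 0" if "i \<ge> N" for i
    using that P by (simp add: coeff_eq_0)
  have deg: "degree (Polynomial.smult a P + Polynomial.smult b Q) < N" for a b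
  proof -
    have "degree (Polynomial.smult a P + Polynomial.smult b Q) \<le> N - 1"
      by (rule degree_le) (use N cP cQ in auto)
    then show ?thesis using N by simp
  qed
  have X: "cnj (X \<theta>) = cis (- ((real N - 1) / 2 * \<theta>)) * poly Q (cis \<theta>)" for \<theta>
  proof -
    have "{..N - 1} = {..<N}" using N by auto
    then have "poly P (cis \<theta>) = (\<Sum>i<N. coeff P i * cis \<theta> ^ i)"
      using poly_eq_sum_atMost[of P "N - 1" "cis \<theta>"] P by simp
    then have "cnj (X \<theta>) = (\<Sum>i<N. cnj (coeff P i) * (cis ((real N - 1) / 2 * \<theta>) * cis (- (real i * \<theta>))))"
      by (simp add: X_def Complex.DeMoivre cis_cnj sum_distrib_left mult_ac)
    also have "\<dots> = (\<Sum>i<N. cnj (coeff P (N - 1 - i)) *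
        (cis ((real N - 1) / 2 * \<theta>) * cis (- (real (N - 1 - i) * \<theta>))))"
      by (rule sum.nat_diff_reindex[symmetric, unfolded Suc_eq_plus1_left diff_diff_left[symmetric]])
    also have "\<dots> = (\<Sum>i<N. cnj (coeff P (N - 1 - i)) * (cis (- ((real N - 1) / 2 * \<theta>)) * cis \<theta> ^ i))"
    proof (intro sum.cong refl)
      fix i assume "i \<in> {..<N}"
      then have "real (N - 1 - i) = real N - 1 - real i" by (simp add: of_nat_diff)
      then have "cis ((real N - 1) / 2 * \<theta>) * cis (- (real (N - 1 - i) * \<theta>)) =
          cis (- ((real N - 1) / 2 * \<theta>)) * cis \<theta> ^ i"
        unfolding Complex.DeMoivre cis_mult by (intro arg_cong[of _ _ cis]) (simp add: field_simps)
      then show "cnj (coeff P (N - 1 - i)) * (cis ((real N - 1) / 2 * \<theta>) * cis (- (real (N - 1 - i) * \<theta>))) =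
          cnj (coeff P (N - 1 - i)) * (cis (- ((real N - 1) / 2 * \<theta>)) * cis \<theta> ^ i)" by (simp only:)
    qed
    also have "\<dots> = cis (- ((real N - 1) / 2 * \<theta>)) * poly Q (cis \<theta>)"
      by (simp add: Q_def poly_sum poly_monom sum_distrib_left mult_ac)
    finally show ?thesis .
  qed
  have "complex_of_real (Re (X \<theta>)) = cis (- ((real N - 1) / 2 * \<theta>)) *
      poly (Polynomial.smult (1/2) P + Polynomial.smult (1/2) Q) (cis \<theta>)" for \<theta>
  proof -
    have "complex_of_real (Re (X \<theta>)) = (1/2) * X \<theta> + (1/2) * cnj (X \<theta>)"
      by (simp add: complex_eq_iff)
    then show ?thesis unfolding X by (simp add: X_def algebra_simps)
  qed
  then show "(\<lambda>\<theta>. Re (X \<theta>)) \<in> trig_space N" unfolding trig_space_def using deg by blast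
  have "complex_of_real (Im (X \<theta>)) = cis (- ((real N - 1) / 2 * \<theta>)) *
      poly (Polynomial.smult (-\<i>/2) P + Polynomial.smult (\<i>/2) Q) (cis \<theta>)" for \<theta>
  proof -
    have "complex_of_real (Im (X \<theta>)) = (-\<i>/2) * X \<theta> + (\<i>/2) * cnj (X \<theta>)"
      by (simp add: complex_eq_iff)
    then show ?thesis unfolding X by (simp add: X_def algebra_simps)
  qed
  then show "(\<lambda>\<theta>. Im (X \<theta>)) \<in> trig_space N" unfolding trig_space_def using deg by blast
qed

section \<open>The functions in the \<open>Trig\<close> lists\<close>

lemma length_Trig: "length (Trig m f) = m"
proof -
  have [simp]: "length (concat (map (\<lambda>k. [g k, h k]) xs)) = 2 * length xs" for g h :: "nat \<Rightarrow> real \<Rightarrow> real" and xs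
    by (induction xs) auto
  show ?thesis
  proof (cases "even m")
    case True
    then show ?thesis by (simp add: Trig_def del: upt_Suc)
  next
    case False
    then have "Suc (2 * ((m - 1) div 2)) = m" by presburger
    with False show ?thesis by (simp add: Trig_def del: upt_Suc)
  qed
qed

lemma set_concat_map_pairs:
  "u \<in> set (concat (map (\<lambda>k. [g k, h k]) xs)) \<Longrightarrow> \<exists>k\<in>set xs. u = g k \<or> u = h k"
  by auto

lemma Trig_in_trig_space:
  assumes "u \<in> set (Trig m f)"
  shows "\<exists>T\<in>trig_space m. u = (\<lambda>\<theta>. f \<theta> * T \<theta>)"
proof (cases "even m")
  case True
  then obtain k where k: "k \<in> {1..<Suc (m div 2)}" and
    u: "u = (\<lambda>\<theta>. f \<theta> * cos ((2 * real k - 1) / 2 * \<theta>)) \<or> u = (\<lambda>\<theta>. f \<theta> * sin ((2 * real k - 1) / 2 * \<theta>))"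
    using set_concat_map_pairs[OF assms[unfolded Trig_def if_P[OF True]]] by (auto simp only: set_upt)
  \<comment> \<open>The two exponents are chosen to add up to \<open>m - 1\<close> and to differ by
    \<open>2 k - 1\<close>.\<close>
  have m: "m = Suc ((m div 2 - 1 + k) + (m div 2 - k))" using True k by auto
  have eq: "real (m div 2 - 1 + k) - real (m div 2 - k) = 2 * real k - 1"
    using k by (auto simp: of_nat_diff)
  note mem = trig_space_cos_sin[OF m, unfolded eq]
  from u show ?thesis
    by (elim disjE) (rule bexI[OF _ mem(1)], assumption, rule bexI[OF _ mem(2)], assumption)
next
  case False
  define M where "M = (m - 1) div 2"
  have m: "m = Suc (M + M)" using False unfolding M_def by presburger
  from False assms consider "u = f" | k where "k \<in> {1..<Suc M}"
    "u = (\<lambda>\<theta>. f \<theta> * cos (real k * \<theta>)) \<or> u = (\<lambda>\<theta>. f \<theta> * sin (real k * \<theta>))"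
  proof -
    have "u = f \<or> u \<in> set (concat (map (\<lambda>k. [\<lambda>\<theta>. f \<theta> * cos (real k * \<theta>),
        \<lambda>\<theta>. f \<theta> * sin (real k * \<theta>)]) [1..<Suc M]))"
      using assms False by (simp only: Trig_def if_False M_def set_simps insert_iff)
    then show thesis
    proof
      assume "u \<in> set (concat (map (\<lambda>k. [\<lambda>\<theta>. f \<theta> * cos (real k * \<theta>),
        \<lambda>\<theta>. f \<theta> * sin (real k * \<theta>)]) [1..<Suc M]))"
      from set_concat_map_pairs[OF this] show thesis using that(2) by (auto simp only: set_upt)
    qed (rule that(1))
  qed
  then show ?thesis
  proof cases
    case 1
    then show ?thesis using trig_space_cos_sin(1)[OF m] by (intro bexI[of _ "\<lambda>_. 1"]) auto
  next
    case (2 k)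
    have m': "m = Suc ((M + k) + (M - k))" using m 2 by auto
    have eq: "(real (M + k) - real (M - k)) / 2 = real k" using 2 by (auto simp: of_nat_diff)
    note mem = trig_space_cos_sin[OF m', unfolded eq]
    from 2(2) show ?thesis
      by (elim disjE) (rule bexI[OF _ mem(1)], assumption, rule bexI[OF _ mem(2)], assumption)
  qed
qed

section \<open>Supports\<close>

lemma circle_prob_sets:
  assumes "circle_prob M" "A \<in> sets borel"
  shows "A \<inter> sphere 0 1 \<in> sets M"
  using assms unfolding circle_prob_def by (simp add: sets_restrict_space) blast

lemma AE_circle_space:
  assumes M: "circle_prob M"
  shows "AE w in M. cmod w = 1"
  using AE_space[of M] by eventually_elim (simp add: circle_prob_space[OF M])

text \<open>The complement of the support in the circle is covered by open null sets, and by
  Lindelof countably many of them suffice.\<close>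

lemma circle_support_full:
  assumes M: "circle_prob M"
  shows "AE w in M. w \<in> circle_support M"
proof -
  define F where "F = {U. open U \<and> emeasure M (U \<inter> sphere 0 1) = 0}"
  obtain F' where F': "F' \<subseteq> F" "countable F'" "\<Union>F' = \<Union>F"
    using Lindelof[of F] unfolding F_def by blast
  have "(\<Union>U\<in>F'. U \<inter> sphere 0 1) \<in> null_sets M"
  proof (rule null_sets_UN'[OF F'(2)])
    fix U assume "U \<in> F'"
    then have "open U" "emeasure M (U \<inter> sphere 0 1) = 0" using F'(1) unfolding F_def by auto
    then show "U \<inter> sphere 0 1 \<in> null_sets M" using circle_prob_sets[OF M, of U] by auto
  qed
  then have "AE w in M. w \<notin> (\<Union>U\<in>F'. U \<inter> sphere 0 1)" by (rule AE_not_in)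
  then show ?thesis using AE_circle_space[OF M]
  proof eventually_elim
    case (elim w)
    have "emeasure M (U \<inter> sphere 0 1) > 0" if U: "open U" "w \<in> U" for U
    proof (rule ccontr)
      assume "\<not> emeasure M (U \<inter> sphere 0 1) > 0"
      then have "U \<in> F" using U(1) unfolding F_def by (simp add: zero_less_iff_neq_zero)
      then have "w \<in> \<Union>F'" using U(2) F'(3) by blast
      then show False using elim by auto
    qed
    then show ?case using elim(2) unfolding circle_support_def by simp
  qed
qed

lemma circle_support_finite:
  assumes M: "circle_prob M" and K: "finite K" and AE: "AE w in M. w \<in> K"
  shows "finite (circle_support M)"
proof (rule finite_subset[OF _ K], rule subsetI, rule ccontr)
  fix x assume x: "x \<in> circle_support M" "x \<notin> K"
  have op: "open (- K)" using K by (simp add: finite_imp_closed open_Compl)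
  then have pos: "emeasure M (- K \<inter> sphere 0 1) > 0"
    using x unfolding circle_support_def by blast
  have "- K \<inter> sphere 0 1 \<in> sets M" using circle_prob_sets[OF M, of "- K"] op by auto
  moreover have "AE w in M. w \<notin> - K \<inter> sphere 0 1" using AE by eventually_elim simp
  ultimately have "- K \<inter> sphere 0 1 \<in> null_sets M" by (simp add: AE_iff_null_sets)
  then show False using pos by (simp add: null_sets_def)
qed

text \<open>This is how infinite support enters: if the integral vanished, the measure would be
  concentrated on the finitely many zeros of \<open>f\<close>.\<close>

lemma infinite_support_integral_nonzero:
  assumes M: "circle_prob M" "infinite (circle_support M)"
    and AE: "AE w in M. arg_from t0 w \<in> A"
    and nn: "\<And>x. x \<in> A \<Longrightarrow> 0 \<le> f x" and fin: "finite {x \<in> A. f x = 0}"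
    and int: "integrable M (\<lambda>w. f (arg_from t0 w))"
  shows "(LINT w|M. f (arg_from t0 w)) \<noteq> (0::real)"
proof
  assume "(LINT w|M. f (arg_from t0 w)) = 0"
  moreover have "AE w in M. 0 \<le> f (arg_from t0 w)" using AE by eventually_elim (rule nn)
  ultimately have "AE w in M. f (arg_from t0 w) = 0"
    using integral_nonneg_eq_0_iff_AE[OF int] by blast
  then have "AE w in M. w \<in> cis ` {x \<in> A. f x = 0}"
    using AE AE_circle_space[OF M(1)]
  proof eventually_elim
    case (elim w)
    then show ?case using cis_arg_from[of w t0] by (intro image_eqI[of _ _ "arg_from t0 w"]) auto
  qed
  then have "finite (circle_support M)" by (rule circle_support_finite[OF M(1) finite_imageI[OF fin]])
  then show False using M(2) by blast
qed

text \<open>Of all angles of the arc only \<open>t0 + 2 pi\<close> lies outside the range of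
  \<open>arg_from t0\<close>; it is sent to \<open>t0\<close>.\<close>

lemma arg_from_circle_arc:
  assumes w: "w \<in> circle_arc a b" and t0: "t0 \<le> a" "b \<le> t0 + 2 * pi"
  shows "arg_from t0 w \<in> {a..b} \<or> b = t0 + 2 * pi \<and> w = cis t0"
proof -
  obtain \<theta> where \<theta>: "a \<le> \<theta>" "\<theta> \<le> b" "w = cis \<theta>" using w unfolding circle_arc_def by auto
  show ?thesis
  proof (cases "\<theta> < t0 + 2 * pi")
    case True
    then show ?thesis using arg_from_cis[of t0 \<theta>] \<theta> t0 by auto
  next
    case False
    then have "\<theta> = t0 + 2 * pi" "b = t0 + 2 * pi" using \<theta> t0 by auto
    moreover have "cis (t0 + 2 * pi) = cis t0" by (simp flip: cis_mult)
    ultimately show ?thesis using \<theta> by simp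
  qed
qed

lemma trig_space_arg_from_measurable:
  assumes "T \<in> trig_space p"
  shows "(\<lambda>w. T (arg_from t0 w)) \<in> borel_measurable borel"
  by (rule measurable_compose[OF arg_from_measurable
        borel_measurable_continuous_onI[OF trig_space_continuous[OF assms]]])

lemma trig_space_prod_integrable:
  assumes M: "circle_prob M" and S: "S \<in> trig_space a" and T: "T \<in> trig_space b"
  shows "integrable M (\<lambda>w. S (arg_from t0 w) * T (arg_from t0 w))"
proof -
  have "compact ((\<lambda>x. S x * T x) ` {t0..t0 + 2 * pi})"
    by (intro compact_continuous_image continuous_intros trig_space_continuous[OF S]
        trig_space_continuous[OF T]) simp
  then have "bounded ((\<lambda>x. S x * T x) ` {t0..t0 + 2 * pi})" by (rule compact_imp_bounded)
  then obtain B where B: "\<And>x. x \<in> {t0..t0 + 2 * pi} \<Longrightarrow> norm (S x * T x) \<le> B"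
    unfolding bounded_iff by blast
  show ?thesis
  proof (rule circle_prob_integrable[OF M])
    show "(\<lambda>w. S (arg_from t0 w) * T (arg_from t0 w)) \<in> borel_measurable borel"
      by (intro borel_measurable_times trig_space_arg_from_measurable[OF S]
          trig_space_arg_from_measurable[OF T])
    show "norm (S (arg_from t0 w) * T (arg_from t0 w)) \<le> B" for w
      using arg_from_range[where ?t0.0 = t0 and z = w] by (intro B) auto
  qed
qed

section \<open>Orthogonality on the circle\<close>

text \<open>Since \<open>2 - N - p = -(N - 1) - (p - 1)\<close>, the half power is the product of
  the central factors of \<open>X\<close> and \<open>T\<close>, and \<open>X\<close> times
  \<open>T\<close> is the combination of the given integrands with the coefficients of
  \<open>q\<close>. As \<open>T\<close> is real, the real and imaginary parts of \<open>X\<close>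
  separate.\<close>

lemma orthogonal_trig_space:
  assumes M: "circle_prob M" and P: "degree P < N"
    and orth: "\<And>l. l < p \<Longrightarrow> (LINT w|M. poly P w * w ^ l * half_pow t0 (2 - int N - int p) w) = 0"
    and T: "T \<in> trig_space p"
  defines "X \<equiv> \<lambda>\<theta>. cis (- ((real N - 1) / 2 * \<theta>)) * poly P (cis \<theta>)"
  shows "(LINT w|M. Re (X (arg_from t0 w)) * T (arg_from t0 w)) = 0"
    and "(LINT w|M. Im (X (arg_from t0 w)) * T (arg_from t0 w)) = 0"
proof -
  obtain q where q: "degree q < p"
    "\<And>\<theta>. complex_of_real (T \<theta>) = cis (- ((real p - 1) / 2 * \<theta>)) * poly q (cis \<theta>)"
    using T unfolding trig_space_def by blast
  define Y where "Y w = (\<Sum>l<p. coeff q l * (poly P w * w ^ l * half_pow t0 (2 - int N - int p) w))" for w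
  have b: "circle_bounded (\<lambda>w. poly P w * w ^ l * half_pow t0 (2 - int N - int p) w)" for l
    using circle_bounded_power_int[of "int l"]
    by (intro circle_bounded_mult circle_bounded_half_pow circle_bounded_poly) simp
  have intl: "integrable M (\<lambda>w. coeff q l * (poly P w * w ^ l * half_pow t0 (2 - int N - int p) w))" for l
    by (intro integrable_mult_right circle_bounded_integrable[OF M] b)
  have Yint: "integrable M Y" unfolding Y_def by (intro Bochner_Integration.integrable_sum intl)
  have "(LINT w|M. Y w) = (\<Sum>l<p. coeff q l * (LINT w|M. poly P w * w ^ l * half_pow t0 (2 - int N - int p) w))"
    unfolding Y_def by (subst Bochner_Integration.integral_sum) (rule intl, simp only: integral_mult_right_zero)
  then have Y0: "(LINT w|M. Y w) = 0" using orth by simp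
  have Y: "X (arg_from t0 w) * of_real (T (arg_from t0 w)) = Y w" if w: "w \<in> space M" for w
  proof -
    have w1: "cmod w = 1" using w by (simp add: circle_prob_space[OF M])
    have p0: "p > 0" using q(1) by simp
    define \<theta> where "\<theta> = arg_from t0 w"
    have c: "cis \<theta> = w" unfolding \<theta>_def by (rule cis_arg_from[OF w1])
    have "{..p - 1} = {..<p}" using p0 by auto
    then have qw: "poly q w = (\<Sum>l<p. coeff q l * w ^ l)"
      using poly_eq_sum_atMost[of q "p - 1" w] q(1) by simp
    have "half_pow t0 (2 - int N - int p) w = cis (of_int (2 - int N - int p) / 2 * \<theta>)"
      unfolding \<theta>_def by (rule half_pow_circle[OF w1])
    also have "\<dots> = cis (- ((real N - 1) / 2 * \<theta>)) * cis (- ((real p - 1) / 2 * \<theta>))"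
      unfolding cis_mult by (rule arg_cong[of _ _ cis]) (simp add: field_simps)
    finally have hp: "half_pow t0 (2 - int N - int p) w =
        cis (- ((real N - 1) / 2 * \<theta>)) * cis (- ((real p - 1) / 2 * \<theta>))" .
    have "X \<theta> * of_real (T \<theta>) = poly P w * poly q w * half_pow t0 (2 - int N - int p) w"
      unfolding X_def q(2) c hp by (simp only: mult_ac)
    also have "\<dots> = Y w" unfolding Y_def qw
      by (simp add: sum_distrib_left sum_distrib_right mult_ac)
    finally show ?thesis unfolding \<theta>_def .
  qed
  have "(LINT w|M. Re (X (arg_from t0 w)) * T (arg_from t0 w)) = (LINT w|M. Re (Y w))"
    by (intro Bochner_Integration.integral_cong refl) (simp flip: Y)
  also have "\<dots> = 0" using Y0 Yint by simp
  finally show "(LINT w|M. Re (X (arg_from t0 w)) * T (arg_from t0 w)) = 0" .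
  have "(LINT w|M. Im (X (arg_from t0 w)) * T (arg_from t0 w)) = (LINT w|M. Im (Y w))"
    by (intro Bochner_Integration.integral_cong refl) (simp flip: Y)
  also have "\<dots> = 0" using Y0 Yint by simp
  finally show "(LINT w|M. Im (X (arg_from t0 w)) * T (arg_from t0 w)) = 0" .
qed

section \<open>Sign changes against orthogonality: the Angelesco and the AT case\<close>

text \<open>Where \<open>c\<close> is nonzero, \<open>a\<close> and \<open>b\<close> each vanish or
  have its sign; where \<open>c = 0\<close>, \<open>a\<close> vanishes. In use, \<open>c\<close> is
  the product of the \<open>x - s\<close> over the sign changes.\<close>

lemma nonneg_mult_same_sign:
  fixes a b c :: real
  assumes "0 \<le> a * c" "0 \<le> b * c" "c = 0 \<Longrightarrow> a = 0"
  shows "0 \<le> a * b"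
  using assms by (cases "c > 0"; cases "c < 0") (auto simp: zero_le_mult_iff)

text \<open>The sign changes are taken in the open arcs, which are disjoint as sets of angles, so
  their total is at most the number of zeros of \<open>\<tau>\<close> in one period and hence below
  \<open>N\<close>. Some arc then has fewer than \<open>n j\<close> of them, which leaves room for a
  test function \<open>T\<close> with the same sign changes.\<close>

lemma angelesco_trig_zero:
  assumes ang: "angelesco r \<mu> \<Gamma>" "arcs_ordered t0 r \<Gamma>" "measure (\<mu> r) {cis t0} = 0"
    and \<tau>: "\<tau> \<in> trig_space (index_size r n)"
    and orth: "\<And>j T. j \<in> {1..r} \<Longrightarrow> T \<in> trig_space (n j) \<Longrightarrow>
      (LINT w|\<mu> j. \<tau> (arg_from t0 w) * T (arg_from t0 w)) = 0"
  shows "\<tau> y = 0"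
proof (rule ccontr)
  assume nz: "\<tau> y \<noteq> 0"
  define N where "N = index_size r n"
  obtain \<alpha> \<beta> where arcs: "\<And>j. j \<in> {1..r} \<Longrightarrow> \<Gamma> j = circle_arc (\<alpha> j) (\<beta> j)"
      "\<And>j. j \<in> {1..r} \<Longrightarrow> t0 \<le> \<alpha> j" "\<And>j. j \<in> {1..r} \<Longrightarrow> \<alpha> j \<le> \<beta> j"
      "\<And>j. j \<in> {1..r} \<Longrightarrow> \<beta> j \<le> t0 + 2 * pi" and step: "\<And>j. j \<in> {1..<r} \<Longrightarrow> \<beta> j \<le> \<alpha> (Suc j)"
    using ang(2) unfolding arcs_ordered_def by blast
  have M: "circle_prob (\<mu> j)" "infinite (circle_support (\<mu> j))"
    "circle_support (\<mu> j) \<subseteq> circle_arc (\<alpha> j) (\<beta> j)" if "j \<in> {1..r}" for j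
    using ang(1) arcs(1)[OF that] that unfolding angelesco_def by blast+
  have chain: "\<beta> j \<le> \<alpha> k" if "1 \<le> j" "j < k" "k \<le> r" for j k
    using that(2,3)
  proof (induction k)
    case (Suc k)
    show ?case
    proof (cases "j = k")
      case True
      then show ?thesis using step[of j] that(1) Suc.prems by auto
    next
      case False
      then have "\<beta> j \<le> \<alpha> k" using Suc by auto
      also have "\<alpha> k \<le> \<beta> k" using arcs(3)[of k] Suc.prems that(1) by auto
      also have "\<beta> k \<le> \<alpha> (Suc k)" using step[of k] Suc.prems that(1) by auto
      finally show ?thesis .
    qed
  qed simp
  have AE: "AE w in \<mu> j. arg_from t0 w \<in> {\<alpha> j..\<beta> j}" if j: "j \<in> {1..r}" for j
  proof (cases "j = r")
    case True
    interpret prob_space "\<mu> j" using M(1)[OF j] by (simp add: circle_prob_def)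
    have "{cis t0} \<inter> sphere 0 1 \<in> sets (\<mu> j)" by (rule circle_prob_sets[OF M(1)[OF j]]) simp
    then have "{cis t0} \<in> sets (\<mu> j)" by simp
    moreover have "measure (\<mu> j) {cis t0} = 0" using ang(3) True by simp
    then have "emeasure (\<mu> j) {cis t0} = 0" by (simp add: emeasure_eq_measure)
    ultimately have "{cis t0} \<in> null_sets (\<mu> j)" by (rule null_setsI[rotated])
    then have "AE w in \<mu> j. w \<notin> {cis t0}" by (rule AE_not_in)
    with circle_support_full[OF M(1)[OF j]] show ?thesis
    proof eventually_elim
      case (elim w)
      then show ?case
        using arg_from_circle_arc[of w "\<alpha> j" "\<beta> j" t0] M(3)[OF j] arcs(2,4)[OF j] by blast
    qed
  next
    case False
    \<comment> \<open>If an arc before the last one reached \<open>t0 + 2 pi\<close>, the last arc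
      would shrink to a point, against the infinite support of \<open>\<mu> r\<close>.\<close>
    have "\<beta> j < t0 + 2 * pi"
    proof (rule ccontr)
      assume "\<not> \<beta> j < t0 + 2 * pi"
      moreover have r: "r \<in> {1..r}" using j by auto
      moreover have "\<beta> j \<le> \<alpha> r" using chain[of j r] j False by auto
      ultimately have "\<alpha> r = \<beta> r" using arcs(3,4)[OF r] by linarith
      then have "finite (circle_arc (\<alpha> r) (\<beta> r))" by (simp add: circle_arc_def)
      then show False using M(2,3)[OF r] finite_subset by blast
    qed
    then have ne: "\<beta> j \<noteq> t0 + 2 * pi" by simp
    from circle_support_full[OF M(1)[OF j]] show ?thesis
    proof eventually_elim
      case (elim w)
      then show ?case
        using arg_from_circle_arc[of w "\<alpha> j" "\<beta> j" t0] M(3)[OF j] arcs(2,4)[OF j] ne by blast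
    qed
  qed
  define Z where "Z = {x \<in> {t0..<t0 + 2 * pi}. \<tau> x = 0}"
  have Z: "finite Z" "card Z < N"
    unfolding Z_def N_def using trig_space_zeros[OF \<tau> nz] by blast+
  define R where "R j S \<sigma> \<longleftrightarrow> S \<subseteq> {x \<in> {\<alpha> j<..<\<beta> j}. \<tau> x = 0} \<and> \<bar>\<sigma>\<bar> = 1 \<and>
      (\<forall>x\<in>{\<alpha> j..\<beta> j}. 0 \<le> \<sigma> * \<tau> x * (\<Prod>s\<in>S. x - s))" for j S \<sigma>
  have "\<exists>S \<sigma>. S \<subseteq> {x \<in> {\<alpha> j<..<\<beta> j}. \<tau> x = 0} \<and> \<bar>\<sigma>\<bar> = 1 \<and>
      (\<forall>x\<in>{\<alpha> j..\<beta> j}. 0 \<le> \<sigma> * \<tau> x * (\<Prod>s\<in>S. x - s))" if j: "j \<in> {1..r}" for j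
  proof -
    let ?Z = "{x \<in> {\<alpha> j<..<\<beta> j}. \<tau> x = 0}"
    have "?Z \<subseteq> Z" unfolding Z_def using arcs(2,4)[OF j] by auto
    then have "finite ?Z" using Z(1) finite_subset by blast
    from ex_sign_change_set[OF this arcs(3)[OF j] _ trig_space_continuous[OF \<tau>]]
    show ?thesis by blast
  qed
  then have "\<forall>j\<in>{1..r}. \<exists>S \<sigma>. R j S \<sigma>" unfolding R_def by blast
  then obtain S \<sigma> where R: "\<And>j. j \<in> {1..r} \<Longrightarrow> R j (S j) (\<sigma> j)" by metis
  have S: "\<And>j. j \<in> {1..r} \<Longrightarrow> S j \<subseteq> {x \<in> {\<alpha> j<..<\<beta> j}. \<tau> x = 0}"
    and \<sigma>: "\<And>j. j \<in> {1..r} \<Longrightarrow> \<bar>\<sigma> j\<bar> = 1"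
    and sg: "\<And>j x. j \<in> {1..r} \<Longrightarrow> x \<in> {\<alpha> j..\<beta> j} \<Longrightarrow> 0 \<le> \<sigma> j * \<tau> x * (\<Prod>s\<in>S j. x - s)"
    using R unfolding R_def by blast+
  have SZ: "S j \<subseteq> Z" if "j \<in> {1..r}" for j
    using S[OF that] arcs(2,4)[OF that] unfolding Z_def by fastforce
  have fS: "finite (S j)" if "j \<in> {1..r}" for j using SZ[OF that] Z(1) finite_subset by blast
  have disj: "S j \<inter> S k = {}" if "j \<in> {1..r}" "k \<in> {1..r}" "j < k" for j k
    using S[OF that(1)] S[OF that(2)] chain[of j k] that by fastforce
  have "(\<Sum>j=1..r. card (S j)) = card (\<Union>j\<in>{1..r}. S j)"
    using fS disj by (intro card_UN_disjoint[symmetric]) (auto, metis linorder_neqE_nat disjoint_iff)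
  also have "\<dots> \<le> card Z" using SZ by (intro card_mono[OF Z(1)] UN_least)
  also have "\<dots> < (\<Sum>j=1..r. n j)" using Z(2) unfolding N_def index_size_def .
  finally obtain j where j: "j \<in> {1..r}" "card (S j) < n j"
    by (meson linorder_not_less sum_mono)
  \<comment> \<open>The frequencies change parity with the order, so \<open>T\<close> must be
    brought to order \<open>n j\<close> exactly. The \<open>k\<close> extra factors
    \<open>sin ((x - t0) / 2)\<close> do this; they are nonnegative on
    \<open>{t0..t0 + 2 pi}\<close> and add no sign change.\<close>
  define k where "k = n j - 1 - card (S j)"
  define T where "T x = \<sigma> j * ((\<Prod>s\<in>S j. sin ((x - s) / 2)) * sin ((x - t0) / 2) ^ k)" for x
  have "(\<lambda>x. (\<Prod>s\<in>S j. sin ((x - s) / 2)) * sin ((x - t0) / 2) ^ k) \<in> trig_space (Suc (card (S j) + k))"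
    by (rule trig_space_mult[OF trig_space_prod_sin[OF fS[OF j(1)]] trig_space_power_sin])
  then have "T \<in> trig_space (Suc (0 + (card (S j) + k)))"
    unfolding T_def by (rule trig_space_mult[OF trig_space_const[of "\<sigma> j", unfolded One_nat_def]])
  then have T: "T \<in> trig_space (n j)" using j(2) by (simp add: k_def)
  have "(LINT w|\<mu> j. \<tau> (arg_from t0 w) * T (arg_from t0 w)) \<noteq> 0"
  proof (rule infinite_support_integral_nonzero[OF M(1,2)[OF j(1)] AE[OF j(1)]])
    show "integrable (\<mu> j) (\<lambda>w. \<tau> (arg_from t0 w) * T (arg_from t0 w))"
      by (rule trig_space_prod_integrable[OF M(1)[OF j(1)] \<tau> T])
    have Sin: "t0 < s" "s < t0 + 2 * pi" "\<tau> s = 0" if "s \<in> S j" for s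
      using S[OF j(1)] that arcs(2,4)[OF j(1)] by fastforce+
    show "0 \<le> \<tau> x * T x" if x: "x \<in> {\<alpha> j..\<beta> j}" for x
    proof -
      have x': "t0 \<le> x" "x \<le> t0 + 2 * pi" using x arcs(2,4)[OF j(1)] by auto
      have fac: "0 \<le> sin ((x - s) / 2) * (x - s)" if "s \<in> S j" for s
      proof (cases "x \<ge> s")
        case True
        then have "0 \<le> sin ((x - s) / 2)" using Sin[OF that] x' by (intro sin_ge_zero) auto
        then show ?thesis using True by simp
      next
        case False
        then have "0 \<le> sin (- ((x - s) / 2))"
          using Sin[OF that] x' by (intro sin_ge_zero) (simp_all add: field_simps)
        then show ?thesis using False by (simp add: mult_nonpos_nonpos)
      qed
      have "0 \<le> (\<Prod>s\<in>S j. sin ((x - s) / 2) * (x - s))" by (intro prod_nonneg fac)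
      then have B: "0 \<le> (\<Prod>s\<in>S j. sin ((x - s) / 2)) * (\<Prod>s\<in>S j. x - s)"
        by (simp only: prod.distrib)
      have C: "\<sigma> j * \<tau> x = 0" if "(\<Prod>s\<in>S j. x - s) = 0"
        using that fS[OF j(1)] Sin(3) by auto
      have "0 \<le> \<sigma> j * \<tau> x * (\<Prod>s\<in>S j. sin ((x - s) / 2))"
        by (rule nonneg_mult_same_sign[OF sg[OF j(1) x] B C])
      moreover have "0 \<le> sin ((x - t0) / 2) ^ k"
        using x' by (intro zero_le_power sin_ge_zero) auto
      ultimately have "0 \<le> \<sigma> j * \<tau> x * (\<Prod>s\<in>S j. sin ((x - s) / 2)) * sin ((x - t0) / 2) ^ k"
        by (rule mult_nonneg_nonneg)
      then show ?thesis by (simp only: T_def mult_ac)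
    qed
    show "finite {x \<in> {\<alpha> j..\<beta> j}. \<tau> x * T x = 0}"
    proof (rule finite_subset)
      let ?I = "{t0..t0 + 2 * pi}"
      have sub: "{\<alpha> j..\<beta> j} \<subseteq> ?I" using arcs(2,4)[OF j(1)] by auto
      show "{x \<in> {\<alpha> j..\<beta> j}. \<tau> x * T x = 0} \<subseteq>
          {x \<in> ?I. \<tau> x = 0} \<union> (\<Union>s\<in>insert t0 (S j). {x \<in> ?I. sin ((x - s) / 2) = 0})"
        using sub fS[OF j(1)] \<sigma>[OF j(1)] by (auto simp: T_def)
      have "finite {x \<in> ?I. sin ((x - s) / 2) = 0}" for s
        using trig_space_finite_zeros[OF trig_space_sin_diff[of s], where y = "s + pi"] by simp
      then show "finite ({x \<in> ?I. \<tau> x = 0} \<union> (\<Union>s\<in>insert t0 (S j). {x \<in> ?I. sin ((x - s) / 2) = 0}))"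
        using trig_space_finite_zeros[OF \<tau> nz] fS[OF j(1)] by simp
    qed
  qed
  then show False using orth[OF j(1) T] by blast
qed

text \<open>Absorbing the densities \<open>w j\<close> into the test functions moves all integrals
  to the single measure \<open>\<nu>\<close>. Then \<open>\<tau>\<close> is orthogonal to every
  combination of the Chebyshev list, among them one with the sign changes of \<open>\<tau>\<close>
  itself.\<close>

lemma AT_system_trig_zero:
  assumes AT: "AT_system r n t0 \<beta> \<mu>" and \<mu>: "\<And>j. j \<in> {1..r} \<Longrightarrow> circle_prob (\<mu> j)"
    and \<tau>: "\<tau> \<in> trig_space (index_size r n)"
    and orth: "\<And>j T. j \<in> {1..r} \<Longrightarrow> T \<in> trig_space (n j) \<Longrightarrow>
      (LINT w|\<mu> j. \<tau> (arg_from t0 w) * T (arg_from t0 w)) = 0"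
  shows "\<tau> y = 0"
proof (rule ccontr)
  assume nz: "\<tau> y \<noteq> 0"
  define us where "us w = concat (map (\<lambda>j. Trig (n j) (w j)) [1..<Suc r])" for w
  have b: "t0 < \<beta>" "\<beta> \<le> t0 + 2 * pi" using AT unfolding AT_system_def by auto
  obtain \<nu> w where \<nu>: "circle_prob \<nu>" "infinite (circle_support \<nu>)"
      "circle_support \<nu> \<subseteq> circle_arc t0 \<beta>"
    and w: "\<And>j. j \<in> {1..r} \<Longrightarrow> (\<lambda>x. w j (arg_from t0 x)) \<in> borel_measurable \<nu>"
      "\<And>j. j \<in> {1..r} \<Longrightarrow> AE x in \<nu>. 0 \<le> w j (arg_from t0 x)"
      "\<And>j. j \<in> {1..r} \<Longrightarrow> \<mu> j = density \<nu> (\<lambda>x. ennreal (w j (arg_from t0 x)))"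
    and ch: "chebyshev_on t0 \<beta> (us w)"
    using AT unfolding AT_system_def us_def by blast
  let ?us = "us w"
  have len: "length ?us = index_size r n"
    unfolding us_def index_size_def
    by (simp add: length_concat length_Trig o_def interv_sum_list_conv_sum_set_nat
        atLeastLessThanSuc_atLeastAtMost del: upt_Suc)
  have us0: "integrable \<nu> (\<lambda>x. \<tau> (arg_from t0 x) * u (arg_from t0 x)) \<and>
      (LINT x|\<nu>. \<tau> (arg_from t0 x) * u (arg_from t0 x)) = 0" if u: "u \<in> set ?us" for u
  proof -
    from u obtain j where "j \<in> set [1..<Suc r]" "u \<in> set (Trig (n j) (w j))"
      unfolding us_def set_concat set_map by blast
    then have j: "j \<in> {1..r}" "u \<in> set (Trig (n j) (w j))" by auto
    obtain T where T: "T \<in> trig_space (n j)" "u = (\<lambda>\<theta>. w j \<theta> * T \<theta>)"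
      using Trig_in_trig_space[OF j(2)] by blast
    let ?f = "\<lambda>x. \<tau> (arg_from t0 x) * T (arg_from t0 x)"
    have f: "?f \<in> borel_measurable \<nu>"
      by (intro borel_measurable_times circle_prob_measurable[OF \<nu>(1)]
          trig_space_arg_from_measurable[OF \<tau>] trig_space_arg_from_measurable[OF T(1)])
    have eq: "(\<lambda>x. \<tau> (arg_from t0 x) * u (arg_from t0 x)) = (\<lambda>x. w j (arg_from t0 x) *\<^sub>R ?f x)"
      unfolding T(2) by (simp add: mult_ac)
    have "integrable (\<mu> j) ?f" by (rule trig_space_prod_integrable[OF \<mu>[OF j(1)] \<tau> T(1)])
    then have "integrable \<nu> (\<lambda>x. w j (arg_from t0 x) *\<^sub>R ?f x)"
      using integrable_density[OF f w(1,2)[OF j(1)]] w(3)[OF j(1)] by simp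
    moreover have "(LINT x|\<nu>. w j (arg_from t0 x) *\<^sub>R ?f x) = 0"
      using integral_density[OF f w(1,2)[OF j(1)]] w(3)[OF j(1)] orth[OF j(1) T(1)] by simp
    ultimately show ?thesis unfolding eq by blast
  qed
  define Z where "Z = {x \<in> {t0..<t0 + 2 * pi}. \<tau> x = 0}"
  have Z: "finite Z" "card Z < length ?us"
    unfolding Z_def len using trig_space_zeros[OF \<tau> nz] by blast+
  let ?Z = "{x \<in> {t0<..<\<beta>}. \<tau> x = 0}"
  have sub: "?Z \<subseteq> Z" unfolding Z_def using b by auto
  then have "finite ?Z" using Z(1) finite_subset by blast
  from ex_sign_change_set[OF this less_imp_le[OF b(1)] _ trig_space_continuous[OF \<tau>]]
  obtain S \<sigma> where S: "S \<subseteq> ?Z" "\<bar>\<sigma>\<bar> = 1"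
    and sg: "\<And>x. x \<in> {t0..\<beta>} \<Longrightarrow> 0 \<le> \<sigma> * \<tau> x * (\<Prod>s\<in>S. x - s)" by blast
  have fS: "finite S" "card S < length ?us" "S \<subseteq> {t0<..<\<beta>}"
  proof -
    have "S \<subseteq> Z" using S(1) sub by blast
    then show "finite S" "card S < length ?us"
      using finite_subset[OF _ Z(1)] card_mono[OF Z(1), of S] Z(2) by auto
    show "S \<subseteq> {t0<..<\<beta>}" using S(1) by blast
  qed
  obtain c k where c: "k < length ?us" "c k \<noteq> 0"
    and pat: "\<And>x. x \<in> {t0..\<beta>} \<Longrightarrow> 0 \<le> (\<Sum>k<length ?us. c k * (?us ! k) x) * (\<Prod>s\<in>S. x - s)"
    using chebyshev_sign_pattern[OF ch b(1) fS(3,2,1)] by blast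
  define U where "U x = (\<Sum>k<length ?us. c k * (?us ! k) x)" for x
  define f where "f x = \<sigma> * \<tau> x * U x" for x
  \<comment> \<open>The angle \<open>t0 + 2 pi\<close>, if it occurs, is sent to \<open>t0\<close>,
    which belongs to \<open>{t0..\<beta>}\<close> because the arc starts there.\<close>
  have AE: "AE x in \<nu>. arg_from t0 x \<in> {t0..\<beta>}"
    using circle_support_full[OF \<nu>(1)]
  proof eventually_elim
    case (elim x)
    then have "arg_from t0 x \<in> {t0..\<beta>} \<or> x = cis t0"
      using arg_from_circle_arc[of x t0 \<beta> t0] \<nu>(3) b by blast
    then show ?case using arg_from_cis[of t0 t0] b by auto
  qed
  have f_eq: "f (arg_from t0 x) = (\<Sum>k<length ?us. \<sigma> * c k *
      (\<tau> (arg_from t0 x) * (?us ! k) (arg_from t0 x)))" for x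
    unfolding f_def U_def by (simp add: sum_distrib_left mult_ac)
  have ik: "integrable \<nu> (\<lambda>x. \<sigma> * c k * (\<tau> (arg_from t0 x) * (?us ! k) (arg_from t0 x)))"
    if "k \<in> {..<length ?us}" for k
    using us0[of "?us ! k"] that by (intro integrable_mult_right) simp
  have "(LINT x|\<nu>. f (arg_from t0 x)) \<noteq> 0"
  proof (rule infinite_support_integral_nonzero[OF \<nu>(1,2) AE])
    show "integrable \<nu> (\<lambda>x. f (arg_from t0 x))"
      unfolding f_eq by (intro Bochner_Integration.integrable_sum ik)
    show "0 \<le> f x" if x: "x \<in> {t0..\<beta>}" for x
    proof -
      have "\<sigma> * \<tau> x = 0" if "(\<Prod>s\<in>S. x - s) = 0" using that fS(1) S(1) by auto
      then show ?thesis unfolding f_def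
        using nonneg_mult_same_sign[OF sg[OF x] pat[OF x, folded U_def]] by blast
    qed
    show "finite {x \<in> {t0..\<beta>}. f x = 0}"
    proof (rule finite_subset)
      show "{x \<in> {t0..\<beta>}. f x = 0} \<subseteq> {x \<in> {t0..t0 + 2 * pi}. \<tau> x = 0} \<union> {x \<in> {t0..\<beta>}. U x = 0}"
        using b S(2) by (auto simp: f_def)
      show "finite ({x \<in> {t0..t0 + 2 * pi}. \<tau> x = 0} \<union> {x \<in> {t0..\<beta>}. U x = 0})"
        using trig_space_finite_zeros[OF \<tau> nz] chebyshev_finite_zeros[of _ _ _ k c, OF ch c] unfolding U_def by simp
    qed
  qed
  moreover have "(LINT x|\<nu>. f (arg_from t0 x)) = 0"
    unfolding f_eq
    by (subst Bochner_Integration.integral_sum)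
       (rule ik, assumption, rule sum.neutral, use us0 in simp)
  ultimately show False by blast
qed

section \<open>Existence and uniqueness of the solution\<close>

text \<open>The real and imaginary parts of the centred \<open>P\<close> inherit the orthogonality
  and so vanish identically; then every point of the circle is a root of \<open>P\<close>.\<close>

lemma multiple_orthogonal_degree:
  assumes \<mu>: "\<forall>j\<in>{1..r}. circle_prob (\<mu> j)"
    and sys: "(\<exists>\<Gamma>. angelesco r \<mu> \<Gamma> \<and> arcs_ordered t0 r \<Gamma> \<and> measure (\<mu> r) {cis t0} = 0) \<or>
         (\<exists>\<alpha> \<beta>. AT_system r n \<alpha> \<beta> \<mu> \<and> t0 = \<alpha>)"
    and P: "degree P < index_size r n" "multiple_orthogonal t0 r n \<mu> P"
  shows "P = 0"
proof -
  define N where "N = index_size r n"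
  define X where "X \<theta> = cis (- ((real N - 1) / 2 * \<theta>)) * poly P (cis \<theta>)" for \<theta>
  have degP: "degree P < N" using P(1) by (simp add: N_def)
  have zero: "\<tau> y = 0" if \<tau>: "\<tau> \<in> trig_space N"
    "\<And>j T. j \<in> {1..r} \<Longrightarrow> T \<in> trig_space (n j) \<Longrightarrow>
      (LINT w|\<mu> j. \<tau> (arg_from t0 w) * T (arg_from t0 w)) = 0" for \<tau> y
    using sys
  proof (elim disjE exE conjE)
    fix \<Gamma> assume "angelesco r \<mu> \<Gamma>" "arcs_ordered t0 r \<Gamma>" "measure (\<mu> r) {cis t0} = 0"
    from angelesco_trig_zero[OF this \<tau>(1)[unfolded N_def] \<tau>(2)] show ?thesis .
  next
    fix \<alpha> \<beta> assume "AT_system r n \<alpha> \<beta> \<mu>" "t0 = \<alpha>"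
    then have "AT_system r n t0 \<beta> \<mu>" by simp
    from AT_system_trig_zero[OF this _ \<tau>(1)[unfolded N_def] \<tau>(2)] show ?thesis using \<mu> by blast
  qed
  have orth: "(LINT w|\<mu> j. poly P w * w ^ l * half_pow t0 (2 - int N - int (n j)) w) = 0"
    if "j \<in> {1..r}" "l < n j" for j l
    using P(2) that unfolding multiple_orthogonal_def N_def by blast
  have ReX: "Re (X y) = 0" for y
    by (rule zero[of "\<lambda>y. Re (X y)"])
       (use trig_space_Re_Im(1)[OF degP] orthogonal_trig_space(1)[OF _ degP orth] \<mu>
        in \<open>simp_all add: X_def\<close>)
  have ImX: "Im (X y) = 0" for y
    by (rule zero[of "\<lambda>y. Im (X y)"])
       (use trig_space_Re_Im(2)[OF degP] orthogonal_trig_space(2)[OF _ degP orth] \<mu>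
        in \<open>simp_all add: X_def\<close>)
  have "poly P (cis \<theta>) = 0" for \<theta>
  proof -
    have "X \<theta> = 0" using ReX ImX by (simp add: complex_eq_iff)
    then show ?thesis by (simp add: X_def)
  qed
  then have sub: "cis ` {0..<0 + 2 * pi} \<subseteq> {z. poly P z = 0}" by auto
  show "P = 0"
  proof (rule ccontr)
    assume "P \<noteq> 0"
    then have "finite (cis ` {0..<0 + 2 * pi})" using poly_roots_finite sub finite_subset by blast
    then have "finite {0..<0 + 2 * pi}" using finite_imageD inj_on_cis by blast
    then show False using infinite_Ico[of 0 "0 + 2 * pi"] by simp
  qed
qed

lemma ex_multiple_orthogonal:
  assumes \<mu>: "\<forall>j\<in>{1..r}. circle_prob (\<mu> j)"
  shows "\<exists>P. P \<noteq> 0 \<and> degree P \<le> index_size r n \<and> multiple_orthogonal t0 r n \<mu> P"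
proof -
  define N where "N = index_size r n"
  define I where "I = (SIGMA j:{1..r}. {..<n j})"
  define A where "A jl k = (LINT w|\<mu> (fst jl). w ^ k * w ^ snd jl *
      half_pow t0 (2 - int N - int (n (fst jl))) w)" for jl k
  have "card I = N" unfolding I_def N_def index_size_def by (subst card_SigmaI) auto
  moreover have "finite I" unfolding I_def by auto
  ultimately obtain c where c: "\<exists>k<Suc N. c k \<noteq> 0" "\<forall>i\<in>I. (\<Sum>k<Suc N. c k * A i k) = 0"
    using ex_nonzero_homogeneous_solution[of I "Suc N" A] by auto
  define P where "P = (\<Sum>k<Suc N. monom (c k) k)"
  have coeffP: "coeff P k = (if k < Suc N then c k else 0)" for k
    by (simp add: P_def coeff_sum del: sum.lessThan_Suc)
  have polyP: "poly P w = (\<Sum>k<Suc N. c k * w ^ k)" for w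
    by (simp add: P_def poly_sum poly_monom del: sum.lessThan_Suc)
  have "P \<noteq> 0" using c(1) coeffP by (metis coeff_0)
  moreover have "degree P \<le> N" by (rule degree_le) (simp add: coeffP)
  moreover have "multiple_orthogonal t0 r n \<mu> P"
    unfolding multiple_orthogonal_def N_def[symmetric]
  proof (intro ballI allI impI)
    fix j l assume j: "j \<in> {1..r}" and l: "l < n j"
    have M: "circle_prob (\<mu> j)" using \<mu> j by blast
    have b: "circle_bounded (\<lambda>w. w ^ k * w ^ l * half_pow t0 (2 - int N - int (n j)) w)" for k
      using circle_bounded_power_int[of "int l"] circle_bounded_power_int[of "int k"]
      by (intro circle_bounded_mult circle_bounded_half_pow) simp_all
    have "(LINT w|\<mu> j. poly P w * w ^ l * half_pow t0 (2 - int N - int (n j)) w) =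
        (LINT w|\<mu> j. (\<Sum>k<Suc N. c k * (w ^ k * w ^ l * half_pow t0 (2 - int N - int (n j)) w)))"
      unfolding polyP by (simp only: sum_distrib_right mult.assoc)
    also have "\<dots> = (\<Sum>k<Suc N. c k * A (j, l) k)"
      unfolding A_def fst_conv snd_conv
      by (subst Bochner_Integration.integral_sum)
         (intro integrable_mult_right circle_bounded_integrable[OF M] b, simp only: integral_mult_right_zero)
    also have "\<dots> = 0" using c(2) j l unfolding I_def by auto
    finally show "(LINT w|\<mu> j. poly P w * w ^ l * half_pow t0 (2 - int N - int (n j)) w) = 0" .
  qed
  ultimately show ?thesis unfolding N_def by (intro exI[of _ P] conjI)
qed

lemma multiple_orthogonal_diff_smult:
  assumes \<mu>: "\<forall>j\<in>{1..r}. circle_prob (\<mu> j)"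
    and "multiple_orthogonal t0 r n \<mu> P" "multiple_orthogonal t0 r n \<mu> Q"
  shows "multiple_orthogonal t0 r n \<mu> (P - Polynomial.smult c Q)"
  unfolding multiple_orthogonal_def
proof (intro ballI allI impI)
  fix j l assume j: "j \<in> {1..r}" and l: "l < n j"
  let ?h = "half_pow t0 (2 - int (index_size r n) - int (n j))"
  have M: "circle_prob (\<mu> j)" using \<mu> j by blast
  have int: "integrable (\<mu> j) (\<lambda>w. poly R w * w ^ l * ?h w)" for R
    using circle_bounded_power_int[of "int l"]
    by (intro circle_bounded_integrable[OF M] circle_bounded_mult circle_bounded_half_pow
        circle_bounded_poly) simp
  have "(LINT w|\<mu> j. poly (P - Polynomial.smult c Q) w * w ^ l * ?h w) =
      (LINT w|\<mu> j. poly P w * w ^ l * ?h w - c * (poly Q w * w ^ l * ?h w))"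
    by (simp add: algebra_simps)
  also have "\<dots> = (LINT w|\<mu> j. poly P w * w ^ l * ?h w) - c * (LINT w|\<mu> j. poly Q w * w ^ l * ?h w)"
    by (subst Bochner_Integration.integral_diff[OF int integrable_mult_right[OF int]])
       (simp only: integral_mult_right_zero)
  also have "\<dots> = 0" using assms(2,3) j l unfolding multiple_orthogonal_def by simp
  finally show "(LINT w|\<mu> j. poly (P - Polynomial.smult c Q) w * w ^ l * ?h w) = 0" .
qed

theorem mainTheorem6:
  fixes r :: nat and n :: "nat \<Rightarrow> nat" and \<mu> :: "nat \<Rightarrow> complex measure" and t0 :: real
  assumes "r \<ge> 1"
    and "\<forall>j\<in>{1..r}. circle_prob (\<mu> j)"
    and "(\<exists>\<Gamma>. angelesco r \<mu> \<Gamma> \<and> arcs_ordered t0 r \<Gamma> \<and> measure (\<mu> r) {cis t0} = 0) \<or>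
         (\<exists>\<alpha> \<beta>. AT_system r n \<alpha> \<beta> \<mu> \<and> t0 = \<alpha>)"
  shows "\<exists>\<phi>. (\<exists>\<psi>. approx_solution t0 r n \<mu> \<phi> \<psi>) \<and> (\<exists>z. z \<noteq> 0 \<and> \<phi> z \<noteq> 0) \<and>
           (\<forall>\<phi>'. (\<exists>\<psi>'. approx_solution t0 r n \<mu> \<phi>' \<psi>') \<longrightarrow>
              (\<exists>c. \<forall>z. z \<noteq> 0 \<longrightarrow> \<phi>' z = c * \<phi> z))"
proof -
  define N where "N = index_size r n"
  note iff = approx_solution_iff_orthogonal[OF assms(2), of t0 n, folded N_def]
  \<comment> \<open>A solution without a term in \<open>z ^ N\<close> has degree below
    \<open>N\<close> and must vanish, so a solution is determined by its top coefficient.\<close>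
  have small: "P = 0" if "degree P \<le> N" "coeff P N = 0" "multiple_orthogonal t0 r n \<mu> P" for P
  proof (rule ccontr)
    assume "P \<noteq> 0"
    then have "degree P < N" using that(1,2) by (metis le_neq_implies_less leading_coeff_0_iff)
    then show False
      using multiple_orthogonal_degree[OF assms(2,3), of P] that(3) \<open>P \<noteq> 0\<close> by (simp add: N_def)
  qed
  obtain P where P: "P \<noteq> 0" "degree P \<le> N" "multiple_orthogonal t0 r n \<mu> P"
    using ex_multiple_orthogonal[OF assms(2)] unfolding N_def by blast
  define \<phi> where "\<phi> z = half_pow t0 (- int N) z * poly P z" for z
  have lead: "coeff P N \<noteq> 0" using small P by blast
  have sol: "\<exists>\<psi>. approx_solution t0 r n \<mu> \<phi> \<psi>"
    unfolding iff using P by (intro exI[of _ P]) (simp add: \<phi>_def)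
  \<comment> \<open>Values at 0 are unconstrained in \<open>half_span\<close>, so nontriviality
    needs a witness elsewhere; \<open>P\<close> has only finitely many roots.\<close>
  have "\<exists>z. z \<noteq> 0 \<and> poly P z \<noteq> 0"
  proof (rule ccontr)
    assume "\<not> (\<exists>z. z \<noteq> 0 \<and> poly P z \<noteq> 0)"
    then have "UNIV \<subseteq> insert 0 {z. poly P z = 0}" by blast
    then have "finite (UNIV :: complex set)" using poly_roots_finite[OF P(1)] finite_subset by blast
    then show False by (simp add: infinite_UNIV_char_0)
  qed
  then have nz: "\<exists>z. z \<noteq> 0 \<and> \<phi> z \<noteq> 0" unfolding \<phi>_def by auto
  have "\<exists>c. \<forall>z. z \<noteq> 0 \<longrightarrow> \<phi>' z = c * \<phi> z" if "\<exists>\<psi>'. approx_solution t0 r n \<mu> \<phi>' \<psi>'" for \<phi>'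
  proof -
    from that obtain Q where Q: "degree Q \<le> N" "multiple_orthogonal t0 r n \<mu> Q"
      "\<And>z. z \<noteq> 0 \<Longrightarrow> \<phi>' z = half_pow t0 (- int N) z * poly Q z" unfolding iff by blast
    \<comment> \<open>\<open>c\<close> cancels the top coefficient of the difference, which
      \<open>small\<close> then forces to be zero.\<close>
    define c where "c = coeff Q N / coeff P N"
    have "Q - Polynomial.smult c P = 0"
    proof (rule small)
      show "degree (Q - Polynomial.smult c P) \<le> N"
        using Q(1) P(2) by (intro degree_diff_le) (auto intro: order.trans[OF degree_smult_le])
      show "coeff (Q - Polynomial.smult c P) N = 0" using lead by (simp add: c_def)
    qed (rule multiple_orthogonal_diff_smult[OF assms(2) Q(2) P(3)])
    then have "Q = Polynomial.smult c P" by simp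
    then have "\<forall>z. z \<noteq> 0 \<longrightarrow> \<phi>' z = c * \<phi> z" using Q(3) by (simp add: \<phi>_def)
    then show ?thesis by blast
  qed
  with sol nz show ?thesis by blast
qed

end
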